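(* For every odd integer $k\ge 1$, written $k=2\ell+1$, there exists a $k$-touching set of strings $\mathcal{S}_k$ such that the strings of $\mathcal{S}_k$ pairwise touch (i.e. any two of them have a common point) and $|\mathcal{S}_k| = 9\ell = 9(k-1)/2$. Thus $\chi(\mathcal{S}_k) = 9\ell = \left\lceil \frac{9k}{2}\right\rceil - 5$.
   Context: A string is the image of a continuous injective function from $[0,1]$ to $\mathbb{R}^2$; its two ends are the images of $0$ and $1$, and its interior is the image of $(0,1)$. All sets of strings considered are finite, and any two distinct strings in a set intersect in a finite number of points. Two strings $s,t$ cross if there is a common point $p$, interior to both, at which they locally pass through each other: there is an open neighborhood $U$ of $p$ and a homeomorphism from $U$ to $\mathbb{R}^2$ sending $p$ to the origin, $s\cap U$ to the $x$-axis and $t\cap U$ to the $y$-axis. A set of strings is touching if no two of its strings cross. It is $k$-touching if it is touching and every point of the plane is contained in at most $k$ strings of the set. The intersection graph $G(\mathcal{S})$ has vertex set $\mathcal{S}$, two distinct strings being adjacent if and only if they have non-empty intersection; $\chi(\mathcal{S})$ denotes the chromatic number of $G(\mathcal{S})$. *)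

theory Defs
  imports "HOL-Analysis.Analysis"
begin

text \<open>A string is a point set, not a parametrization; \<open>arc\<close> is the library's predicate for a
  continuous injective map on \<open>[0,1]\<close>.\<close>

definition is_string :: "(real^2) set \<Rightarrow> bool" where
  "is_string s \<longleftrightarrow> (\<exists>g. arc g \<and> path_image g = s)"

text \<open>The two ends of an arc do not depend on the parametrization chosen, so neither does
  the interior; the existential quantifier is therefore harmless.\<close>

definition string_interior :: "(real^2) set \<Rightarrow> (real^2) set" where
  "string_interior s = {p. \<exists>g. arc g \<and> path_image g = s \<and> p \<in> g ` {0<..<1}}"

definition crosses :: "(real^2) set \<Rightarrow> (real^2) set \<Rightarrow> bool" where
  "crosses s t \<longleftrightarrow>
     (\<exists>p U h h'. p \<in> string_interior s \<and> p \<in> string_interior t \<and> open U \<and> p \<in> U \<and>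
        homeomorphism U (UNIV :: (real^2) set) h h' \<and> h p = 0 \<and>
        h ` (s \<inter> U) = {x. x $ 2 = 0} \<and> h ` (t \<inter> U) = {x. x $ 1 = 0})"

definition string_set :: "(real^2) set set \<Rightarrow> bool" where
  "string_set S \<longleftrightarrow> finite S \<and> (\<forall>s\<in>S. is_string s) \<and> pairwise (\<lambda>s t. finite (s \<inter> t)) S"

definition touching :: "(real^2) set set \<Rightarrow> bool" where
  "touching S \<longleftrightarrow> string_set S \<and> pairwise (\<lambda>s t. \<not> crosses s t) S"

definition k_touching :: "nat \<Rightarrow> (real^2) set set \<Rightarrow> bool" where
  "k_touching k S \<longleftrightarrow> touching S \<and> (\<forall>p. card {s \<in> S. p \<in> s} \<le> k)"

definition intersection_edges :: "'a set set \<Rightarrow> 'a set set set" where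
  "intersection_edges S = {{s, t} | s t. s \<in> S \<and> t \<in> S \<and> s \<noteq> t \<and> s \<inter> t \<noteq> {}}"

definition proper_colouring :: "'v set \<Rightarrow> 'v set set \<Rightarrow> nat \<Rightarrow> ('v \<Rightarrow> nat) \<Rightarrow> bool" where
  "proper_colouring V E n c \<longleftrightarrow>
     c ` V \<subseteq> {..<n} \<and> (\<forall>u\<in>V. \<forall>v\<in>V. {u, v} \<in> E \<longrightarrow> c u \<noteq> c v)"

text \<open>Every finite loopless graph has a proper colouring; for a graph without a proper colouring
  by finitely many colours the least number is unspecified.\<close>

definition chromatic_number :: "'v set \<Rightarrow> 'v set set \<Rightarrow> nat" where
  "chromatic_number V E = (LEAST n. \<exists>c. proper_colouring V E n c)"

definition string_chi :: "(real^2) set set \<Rightarrow> nat" where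
  "string_chi S = chromatic_number S (intersection_edges S)"

end

theory Submission
  imports Defs "HOL-Library.Code_Binary_Nat"
begin

text \<open>
  A set of strings that are graphs of functions over intervals of the \<open>x\<close>-axis, ordered consistently
  from bottom to top, is touching as soon as two graphs agree in finitely many points only: near a
  common point one of the strings stays weakly above the other, so they cannot pass through each
  other. The strings below are assembled from such graphs, called strands. A string is either one
  strand, or a hook: two strands joined at their common left end or at their common right end.

  Read from left to right, a set of disjoint strands is a stack in which strands appear and disappear.
  Whenever a window of consecutive strands of the stack belongs to at most \<open>k\<close> distinct strings, and
  no string owns two strands of it, that window may be squeezed to a point and released again. This
  makes all strings of the window meet in one point and creates no other contact. So the geometric
  problem becomes a combinatorial one (locale \<open>timetable\<close>): give every strand a life span in such a way
  that any two strings are at some moment at most \<open>2l\<close> places apart in the stack of living strands.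

  The solution uses eleven bundles of \<open>l\<close> parallel strands, numbered \<open>0, ..., 10\<close> from bottom to top.
  Bundles \<open>0\<close> and \<open>2\<close> are joined at the left to \<open>l\<close> nested hooks, bundles \<open>3\<close> and \<open>10\<close> are joined at the
  right, and the other seven consist of \<open>l\<close> strings each, which makes \<open>9l\<close> strings. Starting from the hooks at
  the left, the bundles \<open>1, 7, 6, 5, 4, 10, 3, 9, 8\<close> are inserted in this order, strand by strand;
  then \<open>6, 7, 5, 4, 2, 8, 1, 0, 9\<close> are removed in this order, strand by strand, and \<open>3\<close> and \<open>10\<close> close
  up at the right. A window of length \<open>2l + 1\<close> contains two neighbouring bundles. It also
  contains a single strand together with the next two bundles, provided that the remaining strands of
  the own bundle are not in between; at the moment at which a strand appears or disappears this is
  true for one side of it, namely the side on which its bundle is not yet there or already gone. It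
  is a finite check that these two reasons account for all pairs of bundles
  (\<open>all_bundles_covered\<close>), uniformly in \<open>l\<close>.

  Since the strings pairwise meet, the intersection graph is complete and its chromatic number is
  the number of strings.
\<close>

section \<open>Contacts from one side are not crossings\<close>

definition pt :: "real \<Rightarrow> real \<Rightarrow> real^2" where
  "pt x y = (\<chi> i. if i = 1 then x else y)"

lemma pt_nth [simp]: "pt x y $ 1 = x" "pt x y $ 2 = y"
  by (simp_all add: pt_def)

lemma pt_eq_iff [simp]: "pt x y = pt x' y' \<longleftrightarrow> x = x' \<and> y = y'"
  by (simp add: vec_eq_iff forall_2)

lemma pt_components: "pt (z $ 1) (z $ 2) = z"
  by (simp add: vec_eq_iff forall_2)

lemma continuous_on_pt [continuous_intros]:
  assumes "continuous_on S f" "continuous_on S g"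
  shows "continuous_on S (\<lambda>x. pt (f x) (g x))"
  unfolding pt_def
proof (rule continuous_on_vec_lambda)
  show "continuous_on S (\<lambda>x. if i = 1 then f x else g x)" for i :: 2
    using assms by (cases "i = 1") auto
qed

lemma dist_pt_le: "dist (pt x y) (pt x' y') \<le> \<bar>x - x'\<bar> + \<bar>y - y'\<bar>"
proof -
  have "dist (pt x y) (pt x' y') \<le> (\<Sum>i\<in>UNIV. \<bar>(pt x y - pt x' y') $ i\<bar>)"
    unfolding dist_norm by (rule norm_le_l1_cart)
  then show ?thesis by (simp add: sum_2)
qed

text \<open>If \<open>s\<close> and \<open>t\<close> crossed at \<open>p\<close>, the crossing chart would put \<open>s\<close> on the horizontal and \<open>t\<close> on the
  vertical axis. Then \<open>t\<close> has points near \<open>p\<close> in both open half planes, while a connected set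
  that avoids \<open>s\<close> lies in one of them. So it suffices that near \<open>p\<close> all of \<open>t\<close> but \<open>p\<close> lies in one
  connected set avoiding \<open>s\<close>.\<close>

lemma not_crosses_if_locally_one_sided:
  assumes side: "\<And>p U. \<lbrakk>p \<in> s; p \<in> t; open U; p \<in> U\<rbrakk> \<Longrightarrow>
      \<exists>C V. connected C \<and> C \<subseteq> U - s \<and> open V \<and> p \<in> V \<and> t \<inter> V - {p} \<subseteq> C"
  shows "\<not> crosses s t"
proof (unfold crosses_def, rule notI, elim exE conjE)
  fix p U and h h' :: "real^2 \<Rightarrow> real^2"
  assume U: "open U" "p \<in> U" and hom: "homeomorphism U UNIV h h'" and hp: "h p = 0"
    and hs: "h ` (s \<inter> U) = {x. x $ 2 = 0}" and ht: "h ` (t \<inter> U) = {x. x $ 1 = 0}"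
  have inj: "u = v" if "u \<in> U" "v \<in> U" "h u = h v" for u v
    by (metis homeomorphism_apply1[OF hom that(1)] homeomorphism_apply1[OF hom that(2)] that(3))
  have h'U: "h' x \<in> U" for x
    using homeomorphism_image2[OF hom] rangeI[of h' x] by simp
  have hh': "h (h' x) = x" for x
    by (rule homeomorphism_apply2[OF hom UNIV_I])
  have pre: "z \<in> A" if zU: "z \<in> U" and hz: "h z \<in> h ` (A \<inter> U)" for z A
  proof -
    obtain w where "h z = h w" "w \<in> A \<inter> U" using hz by (rule imageE)
    with inj[of z w] zU show ?thesis by simp
  qed
  have p: "p \<in> s" "p \<in> t" using pre U(2) hp by (simp_all add: hs ht)
  from side[OF p U] obtain C V where C: "connected C" "C \<subseteq> U - s" and V: "open V" "p \<in> V"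
    and tV: "t \<inter> V - {p} \<subseteq> C" by blast
  have h'0: "h' 0 = p" using homeomorphism_apply1[OF hom U(2)] hp by simp
  have conth': "continuous_on UNIV h'" and conth: "continuous_on U h"
    by (rule homeomorphism_cont2[OF hom], rule homeomorphism_cont1[OF hom])
  have "open (h' -` V)" using conth' V(1) by (simp add: continuous_on_open_vimage)
  moreover have "0 \<in> h' -` V" using h'0 V by simp
  ultimately obtain e where e: "e > 0" "ball 0 e \<subseteq> h' -` V" by (meson openE)
  have inC: "h' (pt 0 y) \<in> C" if "y \<noteq> 0" "\<bar>y\<bar> < e" for y
  proof -
    have "dist (pt 0 y) (pt 0 0) < e" using dist_pt_le[of 0 y 0 0] that by simp
    moreover have "pt 0 0 = 0" by (simp add: vec_eq_iff forall_2)
    ultimately have "pt 0 y \<in> ball 0 e" by (simp add: dist_commute)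
    then have "h' (pt 0 y) \<in> V" using e by auto
    moreover have "h' (pt 0 y) \<in> t" using pre[OF h'U] by (simp add: ht hh')
    moreover have "h' (pt 0 y) \<noteq> p" using that(1) hh'[of "pt 0 y"] hp by (metis pt_nth(2) zero_index)
    ultimately show ?thesis using tV by auto
  qed
  have conn: "connected ((\<lambda>z. h z $ 2) ` C)"
    by (intro connected_continuous_image continuous_intros continuous_on_subset[OF conth]) (use C in auto)
  have val: "y \<in> (\<lambda>z. h z $ 2) ` C" if "y \<noteq> 0" "\<bar>y\<bar> < e" for y
    using inC[OF that] hh'[of "pt 0 y"] by (metis image_eqI pt_nth(2))
  have "-e/2 \<in> (\<lambda>z. h z $ 2) ` C" "e/2 \<in> (\<lambda>z. h z $ 2) ` C"
    by (rule val; use e in simp)+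
  then have "{-e/2..e/2} \<subseteq> (\<lambda>z. h z $ 2) ` C"
    by (rule connected_contains_Icc[OF conn])
  moreover have "0 \<in> {-e/2..e/2}" using e by simp
  ultimately have "0 \<in> (\<lambda>z. h z $ 2) ` C" by blast
  then obtain z where z: "z \<in> C" "h z $ 2 = 0" by auto
  have "z \<in> s" using pre[of z s] z C by (auto simp: hs)
  then show False using z C by blast
qed

text \<open>Supplies the connected set for graphs that touch at \<open>x0\<close>: the thin open strip
  immediately above (\<open>\<sigma> = 1\<close>) or below (\<open>\<sigma> = -1\<close>) the graph of \<open>f\<close>.\<close>

lemma graph_lies_on_one_side:
  fixes f g :: "real \<Rightarrow> real"
  assumes e: "e > 0" and cf: "continuous_on UNIV f" and cg: "continuous_on UNIV g"
    and sg: "\<bar>\<sigma>\<bar> = 1"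
    and eq: "f x0 = g x0"
    and lt: "\<And>x. \<bar>x - x0\<bar> < e \<Longrightarrow> x \<noteq> x0 \<Longrightarrow> \<sigma> * (g x - f x) > 0"
    and W: "open W" "pt x0 (f x0) \<in> W" 
    and sW: "s \<inter> W \<subseteq> range (\<lambda>x. pt x (f x))"
    and tW: "t \<inter> W \<subseteq> range (\<lambda>x. pt x (g x))"
    and U: "open U" "pt x0 (f x0) \<in> U"
  shows "\<exists>C V. connected C \<and> C \<subseteq> U - s \<and> open V \<and> pt x0 (f x0) \<in> V \<and> t \<inter> V - {pt x0 (f x0)} \<subseteq> C"
proof -
  define y0 where "y0 = f x0"
  have "open (U \<inter> W)" "pt x0 y0 \<in> U \<inter> W" using U W by (auto simp: y0_def)
  then obtain r where r: "r > 0" "ball (pt x0 y0) r \<subseteq> U \<inter> W" by (meson openE)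
  have "\<exists>d>0. \<forall>x. \<bar>x - x0\<bar> < d \<longrightarrow> \<bar>f x - y0\<bar> < r/4"
    using cf r unfolding continuous_on_iff y0_def dist_real_def
    by (metis UNIV_I zero_less_divide_iff zero_less_numeral)
  then obtain d1 where d1: "d1 > 0" "\<And>x. \<bar>x - x0\<bar> < d1 \<Longrightarrow> \<bar>f x - y0\<bar> < r/4" by blast
  have "\<exists>d>0. \<forall>x. \<bar>x - x0\<bar> < d \<longrightarrow> \<bar>g x - y0\<bar> < r/4"
    using cg r unfolding continuous_on_iff y0_def eq dist_real_def
    by (metis UNIV_I zero_less_divide_iff zero_less_numeral)
  then obtain d2 where d2: "d2 > 0" "\<And>x. \<bar>x - x0\<bar> < d2 \<Longrightarrow> \<bar>g x - y0\<bar> < r/4" by blast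
  define d where "d = Min {d1, d2, e, r/4}"
  have d: "d > 0" "d \<le> d1" "d \<le> d2" "d \<le> e" "d \<le> r/4" using d1 d2 e r by (auto simp: d_def)
  define C where "C = (\<lambda>(x,u). pt x (f x + \<sigma> * u)) ` ({x0-d<..<x0+d} \<times> {0<..<r/2})"
  define V where "V = W \<inter> (\<lambda>z. z $ 1) -` {x0-d<..<x0+d}"
  have inball: "z \<in> ball (pt x0 y0) r" if zC: "z \<in> C" for z
  proof -
    obtain x u where z: "z = pt x (f x + \<sigma> * u)" "\<bar>x - x0\<bar> < d" "0 < u" "u < r/2"
    proof -
      obtain w where w: "w \<in> {x0-d<..<x0+d} \<times> {0<..<r/2}" "z = (\<lambda>(x,u). pt x (f x + \<sigma> * u)) w"
        using zC unfolding C_def by blast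
      then have "\<bar>fst w - x0\<bar> < d" by (cases w) auto
      with w show thesis by (intro that[of "fst w" "snd w"]) (auto simp: split_beta)
    qed
    have "\<bar>f x + \<sigma> * u - y0\<bar> \<le> \<bar>f x - y0\<bar> + u" using sg z(3) by (auto simp: abs_if split: if_splits)
    moreover have "\<bar>f x - y0\<bar> < r/4" using d1(2) z d by auto
    ultimately have "\<bar>x - x0\<bar> + \<bar>f x + \<sigma> * u - y0\<bar> < r" using z d by linarith
    then show ?thesis using dist_pt_le[of x "f x + \<sigma> * u" x0 y0] by (simp add: z dist_commute)
  qed
  have "connected C" unfolding C_def
  proof (rule connected_continuous_image)
    show "continuous_on ({x0-d<..<x0+d} \<times> {0<..<r/2}) (\<lambda>(x,u). pt x (f x + \<sigma> * u))"
      unfolding split_beta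
      by (intro continuous_intros continuous_on_compose2[OF cf]) auto
    show "connected ({x0-d<..<x0+d} \<times> {0<..<r/2})" by (intro connected_Times) auto
  qed
  moreover have "C \<inter> s = {}"
  proof (rule ccontr)
    assume "C \<inter> s \<noteq> {}"
    then obtain z where z: "z \<in> C" "z \<in> s" by auto
    then have "z \<in> range (\<lambda>x. pt x (f x))" using inball r sW by blast
    then show False using z(1) sg by (auto simp: C_def)
  qed
  moreover have "C \<subseteq> U" using inball r by blast
  moreover have "open V" unfolding V_def
    by (intro open_Int W(1) open_vimage continuous_intros open_greaterThanLessThan)
  moreover have "pt x0 (f x0) \<in> V" using W d by (simp add: V_def)
  moreover have "t \<inter> V - {pt x0 (f x0)} \<subseteq> C"
  proof
    fix z assume z: "z \<in> t \<inter> V - {pt x0 (f x0)}"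
    then obtain x where x: "z = pt x (g x)" using tW by (auto simp: V_def)
    have xd: "\<bar>x - x0\<bar> < d" using z by (auto simp: V_def x abs_if)
    have "x \<noteq> x0" using z eq by (auto simp: x)
    then have u0: "\<sigma> * (g x - f x) > 0" using lt xd d by auto
    have "\<bar>\<sigma> * (g x - f x)\<bar> = \<bar>g x - f x\<bar>" using sg by (simp add: abs_mult)
    also have "\<dots> < r/2" using d1(2)[of x] d2(2)[of x] xd d by linarith
    finally have u1: "\<sigma> * (g x - f x) < r/2" by linarith
    \<comment> \<open>the strip coordinate of a point of \<open>t\<close> is its vertical distance to the graph of \<open>f\<close>\<close>
    have "\<sigma> * \<sigma> = 1" using sg by (auto simp: abs_if split: if_splits)
    then have "g x = f x + \<sigma> * (\<sigma> * (g x - f x))" by (simp add: mult.assoc[symmetric])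
    then have "z = (\<lambda>(x,u). pt x (f x + \<sigma> * u)) (x, \<sigma> * (g x - f x))" by (simp add: x)
    moreover have "(x, \<sigma> * (g x - f x)) \<in> {x0-d<..<x0+d} \<times> {0<..<r/2}"
      using u0 u1 xd by (auto simp: abs_if split: if_splits)
    ultimately show "z \<in> C" unfolding C_def by (rule image_eqI)
  qed
  ultimately show ?thesis unfolding y0_def by blast
qed

section \<open>Strings assembled from graphs\<close>

definition graph_on :: "(real \<Rightarrow> real) \<Rightarrow> real \<Rightarrow> real \<Rightarrow> (real^2) set" where
  "graph_on f a b = (\<lambda>x. pt x (f x)) ` {a..b}"

lemma pt_mem_graph_on [simp]: "pt x y \<in> graph_on f a b \<longleftrightarrow> a \<le> x \<and> x \<le> b \<and> y = f x"
  by (auto simp: graph_on_def)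

lemma arc_graph_on:
  assumes "continuous_on UNIV f" "a < b"
  obtains g where "arc g" "path_image g = graph_on f a b"
    "pathstart g = pt a (f a)" "pathfinish g = pt b (f b)"
proof
  let ?h = "\<lambda>x. pt x (f x)"
  have cont: "continuous_on A ?h" for A
    by (intro continuous_intros continuous_on_subset[OF assms(1)]) auto
  have img: "path_image (linepath a b) = {a..b}"
    using assms(2) by (simp add: closed_segment_eq_real_ivl)
  have "inj_on (?h \<circ> linepath a b) {0..1}"
    using arc_linepath[of a b] assms(2) by (intro comp_inj_on) (auto simp: arc_def inj_on_def)
  then show "arc (?h \<circ> linepath a b)"
    unfolding arc_def by (intro conjI path_continuous_image cont path_linepath)
  show "path_image (?h \<circ> linepath a b) = graph_on f a b"
    by (simp only: path_image_compose img graph_on_def)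
  show "pathstart (?h \<circ> linepath a b) = pt a (f a)" "pathfinish (?h \<circ> linepath a b) = pt b (f b)"
    by (simp_all add: pathstart_compose pathfinish_compose)
qed

lemma closed_graph_on:
  assumes "continuous_on UNIV f"
  shows "closed (graph_on f a b)"
  unfolding graph_on_def
  by (intro compact_imp_closed compact_continuous_image continuous_intros continuous_on_subset[OF assms]) auto

lemma infinite_string:
  assumes "is_string s"
  shows "infinite s"
proof -
  obtain g where g: "arc g" "path_image g = s" using assms by (auto simp: is_string_def)
  have "inj_on g {0..1::real}" using g by (simp add: arc_def)
  then have "finite s \<Longrightarrow> finite {0..1::real}"
    using g(2) finite_imageD[of g] by (simp add: path_image_def)
  then show ?thesis using infinite_Icc[of 0 "1::real"] by auto
qed

text \<open>The abstract shape of the configuration. The strands \<open>q \<in> J\<close> are the graphs of \<open>F q\<close> over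
  \<open>[a q, b q]\<close>, with smaller indices lying weakly below larger ones. The involution \<open>mate\<close> pairs the two strands of
  a hook, which share exactly one common end point, and fixes the strands that are strings on their
  own. Strands of different strings meet only over the finite set \<open>X\<close>, and never
  at an end, so that end points of strings need no separate treatment.\<close>

locale strand_family =
  fixes J :: "nat set" and F :: "nat \<Rightarrow> real \<Rightarrow> real" and a b :: "nat \<Rightarrow> real"
    and mate :: "nat \<Rightarrow> nat" and X :: "real set"
  assumes finite_J: "finite J" and finite_X: "finite X"
    and cont: "q \<in> J \<Longrightarrow> continuous_on UNIV (F q)"
    and nonempty: "q \<in> J \<Longrightarrow> a q < b q"
    and mate: "q \<in> J \<Longrightarrow> mate q \<in> J" "q \<in> J \<Longrightarrow> mate (mate q) = q"
    and hook: "q \<in> J \<Longrightarrow> mate q \<noteq> q \<Longrightarrow>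
        \<exists>z. (z = a q \<and> z = a (mate q) \<or> z = b q \<and> z = b (mate q)) \<and> F q z = F (mate q) z \<and>
          (\<forall>x. a q \<le> x \<and> x \<le> b q \<and> a (mate q) \<le> x \<and> x \<le> b (mate q) \<and> F q x = F (mate q) x \<longrightarrow> x = z)"
    and ordered: "\<lbrakk>q \<in> J; r \<in> J; q < r; a q \<le> x; x \<le> b q; a r \<le> x; x \<le> b r\<rbrakk> \<Longrightarrow> F q x \<le> F r x"
    and meet: "\<lbrakk>q \<in> J; r \<in> J; r \<noteq> q; r \<noteq> mate q; a q \<le> x; x \<le> b q; a r \<le> x; x \<le> b r; F q x = F r x\<rbrakk>
        \<Longrightarrow> x \<in> X \<and> a q < x \<and> x < b q \<and> a r < x \<and> x < b r"
begin

definition strand :: "nat \<Rightarrow> (real^2) set" where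
  "strand q = graph_on (F q) (a q) (b q)"

definition string_of :: "nat \<Rightarrow> (real^2) set" where
  "string_of q = strand q \<union> strand (mate q)"

lemma string_of_mate: "q \<in> J \<Longrightarrow> string_of (mate q) = string_of q"
  using mate by (auto simp: string_of_def)

lemma closed_strand: "q \<in> J \<Longrightarrow> closed (strand q)"
  unfolding strand_def by (intro closed_graph_on cont)

lemma is_string_string_of:
  assumes q: "q \<in> J"
  shows "is_string (string_of q)"
proof (cases "mate q = q")
  case True
  then show ?thesis
    using arc_graph_on[OF cont nonempty] q by (metis is_string_def string_of_def strand_def sup.idem)
next
  case False
  let ?r = "mate q"
  obtain g where g: "arc g" "path_image g = strand q"
    "pathstart g = pt (a q) (F q (a q))" "pathfinish g = pt (b q) (F q (b q))"
    using arc_graph_on[OF cont nonempty] q unfolding strand_def by metis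
  obtain h where h: "arc h" "path_image h = strand ?r"
    "pathstart h = pt (a ?r) (F ?r (a ?r))" "pathfinish h = pt (b ?r) (F ?r (b ?r))"
    using arc_graph_on[OF cont nonempty] mate(1)[OF q] unfolding strand_def by metis
  obtain z where z: "z = a q \<and> z = a ?r \<or> z = b q \<and> z = b ?r" "F q z = F ?r z"
    and only: "\<And>x. a q \<le> x \<and> x \<le> b q \<and> a ?r \<le> x \<and> x \<le> b ?r \<and> F q x = F ?r x \<Longrightarrow> x = z"
    using hook[OF q False] by blast
  have inter: "strand q \<inter> strand ?r \<subseteq> {pt z (F q z)}"
  proof
    fix p assume "p \<in> strand q \<inter> strand ?r"
    then have "pt (p $ 1) (p $ 2) \<in> graph_on (F q) (a q) (b q)" "pt (p $ 1) (p $ 2) \<in> graph_on (F ?r) (a ?r) (b ?r)"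
      by (simp_all add: strand_def pt_components)
    then have "p $ 1 = z" "p $ 2 = F q z" using only[of "p $ 1"] by auto
    then show "p \<in> {pt z (F q z)}" using pt_components[of p] by simp
  qed
  from z(1) have "\<exists>k. arc k \<and> path_image k = strand q \<union> strand ?r"
  proof
    assume *: "z = a q \<and> z = a ?r"
    have "arc (reversepath g +++ h)"
      by (rule arc_join) (use g h * z(2) inter in \<open>auto simp: arc_reversepath\<close>)
    moreover have "path_image (reversepath g +++ h) = strand q \<union> strand ?r"
      using g h * z(2) by (subst path_image_join) auto
    ultimately show ?thesis by blast
  next
    assume *: "z = b q \<and> z = b ?r"
    have "arc (g +++ reversepath h)"
      by (rule arc_join) (use g h * z(2) inter in \<open>auto simp: arc_reversepath\<close>)
    moreover have "path_image (g +++ reversepath h) = strand q \<union> strand ?r"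
      using g h * z(2) by (subst path_image_join) auto
    ultimately show ?thesis by blast
  qed
  then show ?thesis unfolding is_string_def string_of_def by blast
qed

lemma strand_memD:
  assumes "p \<in> strand q"
  shows "a q \<le> p $ 1" "p $ 1 \<le> b q" "p $ 2 = F q (p $ 1)"
  using assms by (auto simp: strand_def graph_on_def)

lemma common_pointE:
  assumes "q \<in> J" "r \<in> J" "r \<noteq> q" "r \<noteq> mate q" "p \<in> string_of q" "p \<in> string_of r"
  obtains q' r' where "q' \<in> {q, mate q}" "r' \<in> {r, mate r}" "q' \<in> J" "r' \<in> J" "r' \<noteq> q'" "r' \<noteq> mate q'"
    "p \<in> strand q'" "p \<in> strand r'"
    "string_of q' = string_of q" "string_of r' = string_of r"
proof -
  obtain q' where q': "q' \<in> {q, mate q}" "p \<in> strand q'" using assms by (auto simp: string_of_def)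
  obtain r' where r': "r' \<in> {r, mate r}" "p \<in> strand r'" using assms by (auto simp: string_of_def)
  have J: "q' \<in> J" "r' \<in> J" using q' r' assms mate by auto
  have ne: "r' \<noteq> q'" "r' \<noteq> mate q'" using q' r' assms mate by (metis insert_iff singletonD)+
  have so: "string_of q' = string_of q" "string_of r' = string_of r"
    using q' r' assms string_of_mate by auto
  show thesis by (rule that[OF q'(1) r'(1) J ne q'(2) r'(2) so])
qed

lemma finite_string_inter:
  assumes "q \<in> J" "r \<in> J" "r \<noteq> q" "r \<noteq> mate q"
  shows "finite (string_of q \<inter> string_of r)"
proof (rule finite_subset)
  show "string_of q \<inter> string_of r \<subseteq> (\<lambda>(x,i). pt x (F i x)) ` (X \<times> J)"
  proof
    fix p assume "p \<in> string_of q \<inter> string_of r"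
    then obtain q' r' where *: "q' \<in> J" "r' \<in> J" "r' \<noteq> q'" "r' \<noteq> mate q'" "p \<in> strand q'" "p \<in> strand r'"
      using common_pointE[OF assms] by (metis IntD1 IntD2)
    have "p $ 1 \<in> X" using meet[OF *(1-4)] strand_memD[OF *(5)] strand_memD[OF *(6)] by metis
    moreover have "p = pt (p $ 1) (F q' (p $ 1))" using strand_memD[OF *(5)] pt_components[of p] by metis
    ultimately show "p \<in> (\<lambda>(x,i). pt x (F i x)) ` (X \<times> J)" using *(1) by force
  qed
  show "finite ((\<lambda>(x,i). pt x (F i x)) ` (X \<times> J))" using finite_J finite_X by simp
qed

lemma inj_string_of:
  assumes "q \<in> J" "r \<in> J" "string_of q = string_of r"
  shows "r = q \<or> r = mate q"
  using finite_string_inter[of q r] infinite_string[OF is_string_string_of] assms by (metis inf.idem)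

text \<open>At an inner point of a strand the other half of a hook is a closed set at positive distance, so
  locally the string is just one graph.\<close>

lemma string_of_local:
  assumes q: "q \<in> J" and p: "p \<in> strand q" "a q < p $ 1" "p $ 1 < b q"
  obtains W where "open W" "p \<in> W" "string_of q \<inter> W \<subseteq> range (\<lambda>x. pt x (F q x))"
proof (cases "mate q = q")
  case True
  show thesis
  proof
    show "open UNIV" "p \<in> UNIV" by auto
    show "string_of q \<inter> UNIV \<subseteq> range (\<lambda>x. pt x (F q x))"
      using True by (auto simp: string_of_def strand_def graph_on_def)
  qed
next
  case False
  let ?r = "mate q"
  have notin: "p \<notin> strand ?r"
  proof
    assume "p \<in> strand ?r"
    then show False
      using hook[OF q False] strand_memD[OF p(1)] strand_memD[of p ?r] p(2,3) by (metis less_irrefl)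
  qed
  show thesis
  proof
    show "open (- strand ?r)" using closed_strand mate(1)[OF q] by auto
    show "p \<in> - strand ?r" using notin by simp
    show "string_of q \<inter> - strand ?r \<subseteq> range (\<lambda>x. pt x (F q x))"
      by (auto simp: string_of_def strand_def graph_on_def)
  qed
qed

lemma not_crosses:
  assumes "q \<in> J" "r \<in> J" "r \<noteq> q" "r \<noteq> mate q"
  shows "\<not> crosses (string_of q) (string_of r)"
proof (rule not_crosses_if_locally_one_sided)
  fix p U assume "p \<in> string_of q" "p \<in> string_of r" and U: "open U" "p \<in> U"
  then obtain q' r' where J: "q' \<in> J" "r' \<in> J" and ne: "r' \<noteq> q'" "r' \<noteq> mate q'" and
    p: "p \<in> strand q'" "p \<in> strand r'" and so: "string_of q' = string_of q" "string_of r' = string_of r"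
    using common_pointE[OF assms] by metis
  define x0 where "x0 = p $ 1"
  note pq = strand_memD[OF p(1), folded x0_def] and pr = strand_memD[OF p(2), folded x0_def]
  have p_eq: "p = pt x0 (F q' x0)" using pt_components[of p] pq by (simp add: x0_def)
  have feq: "F q' x0 = F r' x0" using pq pr by simp
  have strict: "a q' < x0" "x0 < b q'" "a r' < x0" "x0 < b r'"
    using meet[OF J ne pq(1,2) pr(1,2) feq] by auto
  obtain W1 where W1: "open W1" "p \<in> W1" "string_of q' \<inter> W1 \<subseteq> range (\<lambda>x. pt x (F q' x))"
    using string_of_local[OF J(1) p(1)] strict x0_def by metis
  obtain W2 where W2: "open W2" "p \<in> W2" "string_of r' \<inter> W2 \<subseteq> range (\<lambda>x. pt x (F r' x))"
    using string_of_local[OF J(2) p(2)] strict x0_def by metis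
  \<comment> \<open>keep away from the ends of both strands and from the other contact abscissas\<close>
  define D where "D = {x0 - a q', b q' - x0, x0 - a r', b r' - x0} \<union> (\<lambda>x. \<bar>x - x0\<bar>) ` (X - {x0})"
  have D: "finite D" "D \<noteq> {}" "\<And>d. d \<in> D \<Longrightarrow> d > 0"
    using finite_X strict by (auto simp: D_def)
  define e where "e = Min D"
  have e: "e > 0" "\<And>d. d \<in> D \<Longrightarrow> e \<le> d" using D by (auto simp: e_def)
  define \<sigma> :: real where "\<sigma> = (if q' < r' then 1 else -1)"
  have side: "\<sigma> * (F r' x - F q' x) > 0" if "\<bar>x - x0\<bar> < e" "x \<noteq> x0" for x
  proof -
    have dom: "a q' \<le> x" "x \<le> b q'" "a r' \<le> x" "x \<le> b r'"
      using that e(2)[of "x0 - a q'"] e(2)[of "b q' - x0"] e(2)[of "x0 - a r'"] e(2)[of "b r' - x0"]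
      by (auto simp: D_def abs_less_iff)
    have "x \<notin> X" using e(2)[of "\<bar>x - x0\<bar>"] that by (auto simp: D_def)
    then have "F q' x \<noteq> F r' x" using meet[OF J ne dom] by blast
    moreover have "F q' x \<le> F r' x" if "q' < r'" using ordered[OF J that dom] .
    moreover have "F r' x \<le> F q' x" if "r' < q'" using ordered[OF J(2,1) that] dom by blast
    ultimately show ?thesis using ne(1) by (auto simp: \<sigma>_def)
  qed
  have "\<exists>C V. connected C \<and> C \<subseteq> U - string_of q' \<and> open V \<and> pt x0 (F q' x0) \<in> V \<and>
      string_of r' \<inter> V - {pt x0 (F q' x0)} \<subseteq> C"
  proof (rule graph_lies_on_one_side[where \<sigma> = \<sigma> and W = "W1 \<inter> W2" and g = "F r'", OF e(1) cont[OF J(1)] cont[OF J(2)] _ feq side])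
    show "\<bar>\<sigma>\<bar> = 1" by (simp add: \<sigma>_def)
    show "open (W1 \<inter> W2)" "pt x0 (F q' x0) \<in> W1 \<inter> W2" "open U" "pt x0 (F q' x0) \<in> U"
      using W1 W2 U p_eq by auto
    show "string_of q' \<inter> (W1 \<inter> W2) \<subseteq> range (\<lambda>x. pt x (F q' x))" using W1(3) by blast
    show "string_of r' \<inter> (W1 \<inter> W2) \<subseteq> range (\<lambda>x. pt x (F r' x))" using W2(3) by blast
  qed
  then show "\<exists>C V. connected C \<and> C \<subseteq> U - string_of q \<and> open V \<and> p \<in> V \<and> string_of r \<inter> V - {p} \<subseteq> C"
    unfolding so p_eq[symmetric] .
qed

lemma touching_strings: "touching (string_of ` J)"
proof -
  have "pairwise (\<lambda>s t. finite (s \<inter> t) \<and> \<not> crosses s t) (string_of ` J)"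
    unfolding pairwise_def using finite_string_inter not_crosses string_of_mate by (smt (verit) imageE)
  then show ?thesis
    unfolding touching_def string_set_def using finite_J is_string_string_of
    by (auto simp: pairwise_def)
qed

end

section \<open>Squeezing windows of strands to points\<close>

definition tent :: "real \<Rightarrow> real" where
  "tent x = max 0 (1 - 2 * \<bar>x\<bar>)"

lemma tent_bounds: "0 \<le> tent x" "tent x \<le> 1" and tent_eq_1: "tent x = 1 \<longleftrightarrow> x = 0"
  and tent_eq_0: "\<bar>x\<bar> \<ge> 1/2 \<Longrightarrow> tent x = 0" and tent_0 [simp]: "tent 0 = 1"
  by (auto simp: tent_def max_def)

text \<open>Reflection about \<open>cl / 2\<close> pairs the strands folded at the left, reflection about \<open>cr / 2\<close> those
  folded at the right. A common centre of reflection makes the hooks of one side nested.\<close>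

definition partner :: "nat set \<Rightarrow> nat set \<Rightarrow> nat \<Rightarrow> nat \<Rightarrow> nat \<Rightarrow> nat" where
  "partner HL HR cl cr q = (if q \<in> HL then cl - q else if q \<in> HR then cr - q else q)"

text \<open>Strand \<open>q\<close> runs at height \<open>q\<close> and is alive at the contacts
  \<open>first_contact q, ..., last_contact q\<close>; contact \<open>n\<close> takes place
  over the abscissa \<open>n\<close> and squeezes the strands with indices in \<open>[lo n, hi n]\<close> to one point. Strands
  in \<open>HL\<close> are alive from the first contact on and are folded to hooks left of it, strands in \<open>HR\<close> live up to
  the last contact and are folded right of it.\<close>

locale contact_schedule =
  fixes m N k :: nat and first_contact last_contact lo hi :: "nat \<Rightarrow> nat" and HL HR :: "nat set" and cl cr :: nat
  assumes N: "N > 0" and k: "k > 0"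
    and life: "q < m \<Longrightarrow> first_contact q \<le> last_contact q" "q < m \<Longrightarrow> last_contact q < N"
    and HL: "q \<in> HL \<Longrightarrow> q < m \<and> q \<le> cl \<and> cl - q \<in> HL \<and> 2 * q \<noteq> cl \<and> first_contact q = 0"
    and HR: "q \<in> HR \<Longrightarrow> q < m \<and> q \<le> cr \<and> cr - q \<in> HR \<and> 2 * q \<noteq> cr \<and> last_contact q = N - 1"
    and disj: "HL \<inter> HR = {}"
begin

abbreviation mate :: "nat \<Rightarrow> nat" where
  "mate \<equiv> partner HL HR cl cr"

definition window :: "nat \<Rightarrow> nat set" where
  "window n = {q. q < m \<and> lo n \<le> q \<and> q \<le> hi n \<and> first_contact q \<le> n \<and> n \<le> last_contact q}"

definition shift :: "nat \<Rightarrow> nat \<Rightarrow> real" where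
  "shift n q = (if lo n \<le> q \<and> q \<le> hi n then real q - real (lo n) else 0)"

definition squeezed :: "nat \<Rightarrow> real \<Rightarrow> real" where
  "squeezed q x = real q - (\<Sum>n<N. tent (x - real n) * shift n q)"

text \<open>Beyond the range of the contacts a folded strand runs diagonally towards the axis of its fold, where
  it meets its mate; accordingly its domain below extends by its distance from the axis.\<close>

definition height :: "nat \<Rightarrow> real \<Rightarrow> real" where
  "height q x = squeezed q x
     + (if q \<in> HL then sgn (real cl / 2 - real q) * max 0 (-1/2 - x) else 0)
     + (if q \<in> HR then sgn (real cr / 2 - real q) * max 0 (x - (real N - 1/2)) else 0)"

definition left_end :: "nat \<Rightarrow> real" where
  "left_end q = (if q \<in> HL then -1/2 - \<bar>real cl / 2 - real q\<bar> else real (first_contact q) - 1/2)"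

definition right_end :: "nat \<Rightarrow> real" where
  "right_end q = (if q \<in> HR then real N - 1/2 + \<bar>real cr / 2 - real q\<bar> else real (last_contact q) + 1/2)"

text \<open>The tents have disjoint supports, so at most one contact acts at a given abscissa, with the same
  strength \<open>tent \<tau>\<close> on all strands.\<close>

lemma squeezed_cases:
  obtains n \<tau> where "n < N" "x = real n + \<tau>" "\<bar>\<tau>\<bar> < 1/2" "\<And>q. squeezed q x = real q - tent \<tau> * shift n q"
  | "\<And>q. squeezed q x = real q" "\<And>n. n < N \<Longrightarrow> \<bar>x - real n\<bar> \<ge> 1/2"
proof (cases "\<exists>n<N. \<bar>x - real n\<bar> < 1/2")
  case True
  then obtain n where n: "n < N" "\<bar>x - real n\<bar> < 1/2" by blast
  have zero: "tent (x - real i) = 0" if "i \<noteq> n" for i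
  proof (rule tent_eq_0)
    have "\<bar>real i - real n\<bar> \<ge> 1" using that by linarith
    then show "\<bar>x - real i\<bar> \<ge> 1/2" using n(2) by linarith
  qed
  have "(\<Sum>i<N. tent (x - real i) * shift i q) = tent (x - real n) * shift n q" for q
    by (subst sum.remove[of _ n]) (use n zero in auto)
  then show thesis by (intro that(1)[of n "x - real n"]) (use n in \<open>auto simp: squeezed_def\<close>)
next
  case False
  then have far: "\<bar>x - real n\<bar> \<ge> 1/2" if "n < N" for n using that by force
  then show thesis by (intro that(2)) (auto simp: squeezed_def tent_eq_0)
qed

lemma shift_diff:
  assumes "q < r"
  shows "shift n r - shift n q \<le> real r - real q"
    and "shift n r - shift n q = real r - real q \<Longrightarrow> lo n \<le> q \<and> r \<le> hi n"
  using assms by (auto simp: shift_def split: if_splits)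

text \<open>A contact moves the strands of its window down towards its lower bound, where a strand would stay in
  place. This cannot change the order; two strands collapse only if they both belong to the window and
  only at full strength, that is over the contact itself.\<close>

lemma squeezed_mono:
  assumes "q < r"
  shows "squeezed q x \<le> squeezed r x"
    and "squeezed q x = squeezed r x \<Longrightarrow> \<exists>n<N. x = real n \<and> lo n \<le> q \<and> r \<le> hi n"
proof -
  have "squeezed q x \<le> squeezed r x \<and>
    (squeezed q x = squeezed r x \<longrightarrow> (\<exists>n<N. x = real n \<and> lo n \<le> q \<and> r \<le> hi n))"
  proof (cases rule: squeezed_cases[of x])
    case (1 n \<tau>)
    let ?d = "shift n r - shift n q" and ?D = "real r - real q"
    have D: "?D > 0" "?d \<le> ?D" using assms shift_diff by auto
    have diff: "squeezed r x - squeezed q x = ?D - tent \<tau> * ?d" using 1 by (simp add: algebra_simps)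
    have le: "tent \<tau> * ?d \<le> tent \<tau> * ?D" using D tent_bounds by (intro mult_left_mono) auto
    have le': "tent \<tau> * ?D \<le> 1 * ?D" using D tent_bounds by (intro mult_right_mono) auto
    have "\<exists>n<N. x = real n \<and> lo n \<le> q \<and> r \<le> hi n" if "squeezed q x = squeezed r x"
    proof -
      have e: "tent \<tau> * ?d = ?D" using that diff by simp
      then have "tent \<tau> * ?D = ?D" using le le' by simp
      then have t: "tent \<tau> = 1" using D by simp
      with e have "?d = ?D" by simp
      then show ?thesis using shift_diff(2)[OF assms, of n] 1 t by (auto simp: tent_eq_1)
    qed
    then show ?thesis using diff le le' by auto
  next
    case 2
    then show ?thesis using assms by simp
  qed
  then show "squeezed q x \<le> squeezed r x"
    and "squeezed q x = squeezed r x \<Longrightarrow> \<exists>n<N. x = real n \<and> lo n \<le> q \<and> r \<le> hi n" by auto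
qed

lemma squeezed_outside: "x \<le> -1/2 \<or> x \<ge> real N - 1/2 \<Longrightarrow> squeezed q x = real q"
proof (cases rule: squeezed_cases[of x])
  case (1 n \<tau>)
  assume "x \<le> -1/2 \<or> x \<ge> real N - 1/2"
  moreover have "real n + 1 \<le> real N" using 1 by linarith
  ultimately show ?thesis using 1 by linarith
qed

lemma height_inside: "-1/2 \<le> x \<Longrightarrow> x \<le> real N - 1/2 \<Longrightarrow> height q x = squeezed q x"
  by (simp add: height_def max_def)

lemma height_left: "x \<le> -1/2 \<Longrightarrow> q \<in> HL \<Longrightarrow> height q x = real q + sgn (real cl / 2 - real q) * (-1/2 - x)"
  using disj N squeezed_outside[of x q] by (auto simp: height_def max_def)

lemma height_right: "real N - 1/2 \<le> x \<Longrightarrow> q \<in> HR \<Longrightarrow> height q x = real q + sgn (real cr / 2 - real q) * (x - (real N - 1/2))"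
  using disj N squeezed_outside[of x q] by (auto simp: height_def max_def)

lemma height_at_contact: "n < N \<Longrightarrow> lo n \<le> q \<Longrightarrow> q \<le> hi n \<Longrightarrow> height q (real n) = real (lo n)"
proof -
  assume n: "n < N" "lo n \<le> q" "q \<le> hi n"
  have "squeezed q (real n) = real (lo n)"
  proof (cases rule: squeezed_cases[of "real n"])
    case (1 n' \<tau>)
    then have "n' = n" by linarith
    with 1 have "n' = n" "\<tau> = 0" by auto
    then show ?thesis using 1 n by (simp add: shift_def)
  next
    case 2
    then show ?thesis using 2(2)[of n] n by simp
  qed
  then show ?thesis using height_inside[of "real n" q] n by simp
qed

lemma continuous_height: "continuous_on UNIV (height q)"
proof -
  have "continuous_on UNIV (\<lambda>x. s * max 0 (-1/2 - x))" "continuous_on UNIV (\<lambda>x. s * max 0 (x - (real N - 1/2)))" for s :: real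
    by (intro continuous_intros)+
  moreover have "continuous_on UNIV (squeezed q)"
    unfolding squeezed_def[abs_def] tent_def by (intro continuous_intros)
  ultimately show ?thesis unfolding height_def[abs_def] 
    by (cases "q \<in> HL"; cases "q \<in> HR") (auto intro!: continuous_on_add)
qed

text \<open>Strands that approach the axis at equal speed keep their order until they reach it, and only two
  mirror images reach it at the same time and place.\<close>

lemma fold_mono:
  fixes c q r s :: real
  assumes "q < r" "q \<noteq> c" "r \<noteq> c" "0 \<le> s" "s \<le> \<bar>c - q\<bar>" "s \<le> \<bar>c - r\<bar>"
  shows "q + sgn (c - q) * s \<le> r + sgn (c - r) * s"
    and "q + sgn (c - q) * s = r + sgn (c - r) * s \<Longrightarrow> q + r = 2 * c \<and> s = \<bar>c - q\<bar>"
  using assms by (auto simp: sgn_if split: if_splits)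

lemma mate_props: "q < m \<Longrightarrow> mate q < m" "q < m \<Longrightarrow> mate (mate q) = q"
  using HL HR disj by (auto simp: partner_def)

lemma a_less_b: "q < m \<Longrightarrow> left_end q < right_end q"
  using life[of q] by (auto simp: left_end_def right_end_def abs_if)

lemma domain_left: "q < m \<Longrightarrow> left_end q \<le> x \<Longrightarrow> x < -1/2 \<Longrightarrow> q \<in> HL \<and> -1/2 - x \<le> \<bar>real cl / 2 - real q\<bar>"
  by (auto simp: left_end_def split: if_splits)

lemma domain_right: "q < m \<Longrightarrow> x \<le> right_end q \<Longrightarrow> x > real N - 1/2 \<Longrightarrow> q \<in> HR \<and> x - (real N - 1/2) \<le> \<bar>real cr / 2 - real q\<bar>"
  using life[of q] by (auto simp: right_end_def split: if_splits)

text \<open>Left and right of all contacts there are only strands folded on that side, and only folding matters;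
  in between only the contacts matter.\<close>

lemma height_mono:
  assumes q: "q < m" "r < m" "q < r" and dom: "left_end q \<le> x" "x \<le> right_end q" "left_end r \<le> x" "x \<le> right_end r"
  shows "height q x \<le> height r x"
    and "height q x = height r x \<Longrightarrow> (\<exists>n<N. x = real n \<and> lo n \<le> q \<and> r \<le> hi n) \<or>
           r = mate q \<and> (q \<in> HL \<and> x = left_end q \<and> x = left_end r \<or> q \<in> HR \<and> x = right_end q \<and> x = right_end r)"
proof -
  consider "x < -1/2" | "x > real N - 1/2" | "-1/2 \<le> x" "x \<le> real N - 1/2" by linarith
  then have "height q x \<le> height r x \<and> (height q x = height r x \<longrightarrow> (\<exists>n<N. x = real n \<and> lo n \<le> q \<and> r \<le> hi n) \<or>
           r = mate q \<and> (q \<in> HL \<and> x = left_end q \<and> x = left_end r \<or> q \<in> HR \<and> x = right_end q \<and> x = right_end r))"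
  proof cases
    case 1
    have H: "q \<in> HL" "r \<in> HL" "-1/2 - x \<le> \<bar>real cl / 2 - real q\<bar>" "-1/2 - x \<le> \<bar>real cl / 2 - real r\<bar>"
      using domain_left q dom 1 by auto
    have ne: "real q \<noteq> real cl / 2" "real r \<noteq> real cl / 2" using HL[OF H(1)] HL[OF H(2)] by auto
    note f = fold_mono[OF _ ne _ H(3,4)]
    have Fq: "height q x = real q + sgn (real cl / 2 - real q) * (-1/2 - x)"
      and Fr: "height r x = real r + sgn (real cl / 2 - real r) * (-1/2 - x)"
      using height_left H 1 by auto
    have "height q x \<le> height r x" using f(1) q 1 unfolding Fq Fr by simp
    moreover have "r = mate q \<and> (q \<in> HL \<and> x = left_end q \<and> x = left_end r)" if "height q x = height r x"
    proof -
      have "real q + real r = 2 * (real cl / 2) \<and> -1/2 - x = \<bar>real cl / 2 - real q\<bar>"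
        using f(2) q 1 that unfolding Fq Fr by simp
      then have e: "real q + real r = real cl" "-1/2 - x = \<bar>real cl / 2 - real q\<bar>" by auto
      have "q + r = cl" using e(1) by linarith
      moreover have "\<bar>real cl / 2 - real q\<bar> = \<bar>real cl / 2 - real r\<bar>" using e(1) by linarith
      ultimately show ?thesis using e(2) H by (auto simp: partner_def left_end_def)
    qed
    ultimately show ?thesis by blast
  next
    case 2
    have H: "q \<in> HR" "r \<in> HR" "x - (real N - 1/2) \<le> \<bar>real cr / 2 - real q\<bar>" "x - (real N - 1/2) \<le> \<bar>real cr / 2 - real r\<bar>"
      using domain_right q dom 2 by auto
    have ne: "real q \<noteq> real cr / 2" "real r \<noteq> real cr / 2" using HR[OF H(1)] HR[OF H(2)] by auto
    note f = fold_mono[OF _ ne _ H(3,4)]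
    have Fq: "height q x = real q + sgn (real cr / 2 - real q) * (x - (real N - 1/2))"
      and Fr: "height r x = real r + sgn (real cr / 2 - real r) * (x - (real N - 1/2))"
      using height_right H 2 by auto
    have "height q x \<le> height r x" using f(1) q 2 unfolding Fq Fr by simp
    moreover have "r = mate q \<and> (q \<in> HR \<and> x = right_end q \<and> x = right_end r)" if "height q x = height r x"
    proof -
      have "real q + real r = 2 * (real cr / 2) \<and> x - (real N - 1/2) = \<bar>real cr / 2 - real q\<bar>"
        using f(2) q 2 that unfolding Fq Fr by simp
      then have e: "real q + real r = real cr" "x - (real N - 1/2) = \<bar>real cr / 2 - real q\<bar>" by auto
      have "q + r = cr" using e(1) by linarith
      moreover have "\<bar>real cr / 2 - real q\<bar> = \<bar>real cr / 2 - real r\<bar>" using e(1) by linarith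
      moreover have "q \<notin> HL" using H disj by blast
      ultimately show ?thesis using e(2) H by (auto simp: partner_def right_end_def)
    qed
    ultimately show ?thesis by blast
  next
    case 3
    then show ?thesis using squeezed_mono[OF q(3), of x] height_inside by simp
  qed
  then show "height q x \<le> height r x"
    and "height q x = height r x \<Longrightarrow> (\<exists>n<N. x = real n \<and> lo n \<le> q \<and> r \<le> hi n) \<or>
           r = mate q \<and> (q \<in> HL \<and> x = left_end q \<and> x = left_end r \<or> q \<in> HR \<and> x = right_end q \<and> x = right_end r)" by auto
qed

lemma contact_domain:
  assumes "q < m" "n < N"
  shows "left_end q \<le> real n \<and> real n \<le> right_end q \<longleftrightarrow> first_contact q \<le> n \<and> n \<le> last_contact q"
    and "left_end q \<le> real n \<Longrightarrow> real n \<le> right_end q \<Longrightarrow> left_end q < real n \<and> real n < right_end q"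
proof -
  have 1: "left_end q \<le> real n \<longleftrightarrow> first_contact q \<le> n" "left_end q \<le> real n \<Longrightarrow> left_end q < real n"
  proof -
    show "left_end q \<le> real n \<longleftrightarrow> first_contact q \<le> n"
    proof (cases "q \<in> HL")
      case True then show ?thesis using HL[OF True] by (auto simp: left_end_def)
    next
      case False then show ?thesis by (simp add: left_end_def) linarith
    qed
    then show "left_end q \<le> real n \<Longrightarrow> left_end q < real n"
      by (auto simp: left_end_def split: if_splits)
  qed
  have 2: "real n \<le> right_end q \<longleftrightarrow> n \<le> last_contact q" "real n \<le> right_end q \<Longrightarrow> real n < right_end q"
  proof -
    have nN: "real n + 1 \<le> real N" using assms by linarith
    show "real n \<le> right_end q \<longleftrightarrow> n \<le> last_contact q"
    proof (cases "q \<in> HR")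
      case True then show ?thesis using HR[OF True] nN assms by (auto simp: right_end_def)
    next
      case False then show ?thesis by (simp add: right_end_def) linarith
    qed
    then show "real n \<le> right_end q \<Longrightarrow> real n < right_end q"
      using nN by (auto simp: right_end_def split: if_splits)
  qed
  show "left_end q \<le> real n \<and> real n \<le> right_end q \<longleftrightarrow> first_contact q \<le> n \<and> n \<le> last_contact q"
    and "left_end q \<le> real n \<Longrightarrow> real n \<le> right_end q \<Longrightarrow> left_end q < real n \<and> real n < right_end q"
    using 1 2 by auto
qed

end

text \<open>A window must not contain both strands of a hook, as the hook would then pass twice through the
  same point and not be an arc.\<close>

locale touching_schedule = contact_schedule +
  assumes separated: "n < N \<Longrightarrow> u \<in> window n \<Longrightarrow> mate u \<in> window n \<Longrightarrow> mate u = u"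
    and card_window: "n < N \<Longrightarrow> card (window n) \<le> k"
begin

lemma common_contact:
  assumes "q < m" "r < m" "r \<noteq> q" "r \<noteq> mate q"
    and dom: "left_end q \<le> x" "x \<le> right_end q" "left_end r \<le> x" "x \<le> right_end r" and eq: "height q x = height r x"
  obtains n where "n < N" "x = real n" "q \<in> window n" "r \<in> window n"
proof -
  have "\<exists>n<N. x = real n \<and> lo n \<le> q \<and> q \<le> hi n \<and> lo n \<le> r \<and> r \<le> hi n"
  proof (cases "q < r")
    case True
    with height_mono(2)[OF assms(1,2) True dom eq] assms(4) show ?thesis by force
  next
    case False
    then have "r < q" "q \<noteq> mate r" using assms mate_props by auto
    with height_mono(2)[OF assms(2,1) _ dom(3,4,1,2) eq[symmetric]] show ?thesis by force
  qed
  then obtain n where n: "n < N" "x = real n" "lo n \<le> q" "q \<le> hi n" "lo n \<le> r" "r \<le> hi n" by blast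
  then have "q \<in> window n" "r \<in> window n"
    using contact_domain(1)[of q n] contact_domain(1)[of r n] assms by (auto simp: window_def)
  with n show thesis using that by blast
qed

sublocale strand_family "{..<m}" height left_end right_end mate "real ` {..<N}"
proof
  fix q assume "q \<in> {..<m}"
  then have q: "q < m" by simp
  assume ne: "mate q \<noteq> q"
  define r where "r = mate q"
  have r: "r < m" "mate r = q" "r \<noteq> q" using mate_props[OF q] ne by (auto simp: r_def)
  have eq: "x = z" if z: "q \<in> HL \<Longrightarrow> z = left_end q" "q \<in> HR \<Longrightarrow> z = right_end q"
    and x: "left_end q \<le> x" "x \<le> right_end q" "left_end r \<le> x" "x \<le> right_end r" "height q x = height r x" for x z
  proof -
    have HLr: "r \<in> HL \<longleftrightarrow> q \<in> HL" "r \<in> HR \<longleftrightarrow> q \<in> HR"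
      using HL HR disj ne unfolding r_def partner_def by (auto split: if_splits)
    have "(\<exists>n<N. x = real n \<and> lo n \<le> q \<and> q \<le> hi n \<and> lo n \<le> r \<and> r \<le> hi n) \<or> x = z"
    proof (cases "q < r")
      case True
      from height_mono(2)[OF q r(1) True x] show ?thesis using z True by force
    next
      case False
      then have "r < q" using r by simp
      from height_mono(2)[OF r(1) q this x(3,4,1,2) x(5)[symmetric]] show ?thesis using z \<open>r < q\<close> HLr by force
    qed
    moreover have "\<not> (\<exists>n<N. x = real n \<and> lo n \<le> q \<and> q \<le> hi n \<and> lo n \<le> r \<and> r \<le> hi n)"
    proof clarify
      fix n assume n: "n < N" "x = real n" "lo n \<le> q" "q \<le> hi n" "lo n \<le> r" "r \<le> hi n"
      then have "q \<in> window n" "r \<in> window n"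
        using contact_domain(1)[of q n] contact_domain(1)[of r n] x q r by (auto simp: window_def)
      then show False using separated[OF n(1)] ne by (auto simp: r_def)
    qed
    ultimately show ?thesis by blast
  qed
  have "\<exists>z. (z = left_end q \<and> z = left_end r \<or> z = right_end q \<and> z = right_end r) \<and> height q z = height r z \<and> (q \<in> HL \<longrightarrow> z = left_end q) \<and> (q \<in> HR \<longrightarrow> z = right_end q)"
  proof (cases "q \<in> HL")
    case True
    note L = HL[OF True]
    have r': "real r = real cl - real q" "r \<in> HL" using True L by (auto simp: r_def partner_def)
    have ar: "left_end r = left_end q" using True r' by (auto simp: left_end_def)
    have "left_end q \<le> -1/2" using True by (auto simp: left_end_def)
    moreover have "q + sgn (real cl / 2 - real q) * (- 1 / 2 - left_end q) = r + sgn (real cl / 2 - real r) * (- 1 / 2 - left_end r)"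
      using True r' L unfolding ar by (auto simp: left_end_def sgn_if abs_if)
    ultimately have "height q (left_end q) = height r (left_end q)"
      using height_left[of "left_end q" q] height_left[of "left_end q" r] True r' ar by simp
    then show ?thesis using True disj ar by (intro exI[of _ "left_end q"]) auto
  next
    case False
    then have R: "q \<in> HR" using ne by (auto simp: partner_def split: if_splits)
    note L = HR[OF R]
    have r': "real r = real cr - real q" "r \<in> HR" using R False L by (auto simp: r_def partner_def)
    have ar: "right_end r = right_end q" using R r' by (auto simp: right_end_def)
    have "real N - 1/2 \<le> right_end q" using R by (auto simp: right_end_def)
    moreover have "q + sgn (real cr / 2 - real q) * (right_end q - (real N - 1/2)) = r + sgn (real cr / 2 - real r) * (right_end r - (real N - 1/2))"
      using R r' L unfolding ar by (auto simp: right_end_def sgn_if abs_if)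
    ultimately have "height q (right_end q) = height r (right_end q)"
      using height_right[of "right_end q" q] height_right[of "right_end q" r] R r' ar by simp
    then show ?thesis using R False ar by (intro exI[of _ "right_end q"]) auto
  qed
  then obtain z where z: "z = left_end q \<and> z = left_end r \<or> z = right_end q \<and> z = right_end r" "height q z = height r z"
    "q \<in> HL \<Longrightarrow> z = left_end q" "q \<in> HR \<Longrightarrow> z = right_end q" by blast
  have "\<forall>x. left_end q \<le> x \<and> x \<le> right_end q \<and> left_end r \<le> x \<and> x \<le> right_end r \<and> height q x = height r x \<longrightarrow> x = z"
    using eq[OF z(3,4)] by blast
  with z(1,2) show "\<exists>z. (z = left_end q \<and> z = left_end (mate q) \<or> z = right_end q \<and> z = right_end (mate q)) \<and> height q z = height (mate q) z \<and>
      (\<forall>x. left_end q \<le> x \<and> x \<le> right_end q \<and> left_end (mate q) \<le> x \<and> x \<le> right_end (mate q) \<and> height q x = height (mate q) x \<longrightarrow> x = z)"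
    unfolding r_def[symmetric] by blast
next
  fix q r x
  assume "q \<in> {..<m}" "r \<in> {..<m}" "r \<noteq> q" "r \<noteq> mate q" "left_end q \<le> x" "x \<le> right_end q" "left_end r \<le> x" "x \<le> right_end r" "height q x = height r x"
  moreover from this obtain n where "n < N" "x = real n" "q \<in> window n" "r \<in> window n"
    using common_contact by (metis lessThan_iff)
  ultimately show "x \<in> real ` {..<N} \<and> left_end q < x \<and> x < right_end q \<and> left_end r < x \<and> x < right_end r"
    using contact_domain(2) by auto
qed (use mate_props a_less_b continuous_height height_mono(1) in auto)

lemma strings_meet_in_window:
  assumes "n < N" "q \<in> window n" "r \<in> window n"
  shows "string_of q \<inter> string_of r \<noteq> {}"
proof -
  have "pt (real n) (real (lo n)) \<in> strand u" if "u \<in> window n" for u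
    using that height_at_contact[OF assms(1), of u] contact_domain(1)[OF _ assms(1), of u]
    by (simp add: strand_def window_def)
  then show ?thesis using assms by (auto simp: string_of_def)
qed

text \<open>A point on two different strings is the point of some contact, and then every string through it
  owns a strand of that window.\<close>

lemma k_touching_strings: "k_touching k (string_of ` {..<m})"
  unfolding k_touching_def
proof (intro conjI allI touching_strings)
  fix p
  let ?P = "{s \<in> string_of ` {..<m}. p \<in> s}"
  show "card ?P \<le> k"
  proof (cases "\<exists>s t. s \<in> ?P \<and> t \<in> ?P \<and> s \<noteq> t")
    case False
    moreover have "finite ?P" by auto
    ultimately have "card ?P \<le> Suc 0" by (subst card_le_Suc0_iff_eq) auto
    then show ?thesis using k by linarith
  next
    case True
    then obtain q0 r0 where qr: "q0 < m" "r0 < m" "string_of q0 \<noteq> string_of r0" "p \<in> string_of q0" "p \<in> string_of r0"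
      by auto
    then have ne0: "r0 \<noteq> q0" "r0 \<noteq> mate q0" using string_of_mate[of q0] by auto
    obtain q r where q: "q < m" "r < m" "r \<noteq> q" "r \<noteq> mate q" "p \<in> strand q" "p \<in> strand r"
      using common_pointE[of q0 r0 p] qr ne0 by (metis lessThan_iff)
    note pq = strand_memD[OF q(5)] and pr = strand_memD[OF q(6)]
    obtain n where n: "n < N" "p $ 1 = real n" "q \<in> window n" "r \<in> window n"
      using common_contact[OF q(1-4) pq(1,2) pr(1,2)] pq(3) pr(3) by metis
    have "?P \<subseteq> string_of ` window n"
    proof
      fix s assume "s \<in> ?P"
      then obtain u0 where u0: "u0 < m" "s = string_of u0" "p \<in> string_of u0" by auto
      then have "\<exists>u<m. s = string_of u \<and> p \<in> strand u"
        using mate_props[of u0] string_of_mate[of u0] by (force simp: string_of_def[of u0])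
      then obtain u where u: "u < m" "s = string_of u" "p \<in> strand u" by blast
      note pu = strand_memD[OF u(3)]
      show "s \<in> string_of ` window n"
      proof (cases "u = q \<or> u = mate q")
        case True
        then show ?thesis using u(2) n(3) string_of_mate[of q] q by auto
      next
        case False
        then obtain n' where "n' < N" "p $ 1 = real n'" "u \<in> window n'"
          using common_contact[OF q(1) u(1) _ _ pq(1,2) pu(1,2)] pq(3) pu(3) by metis
        then show ?thesis using n u by auto
      qed
    qed
    moreover have "finite (window n)" by (rule finite_subset[of _ "{..<m}"]) (auto simp: window_def)
    ultimately have "card ?P \<le> card (window n)"
      by (meson card_image_le card_mono finite_imageI le_trans)
    then show ?thesis using card_window[OF n(1)] by linarith
  qed
qed

end

section \<open>From life spans to contacts\<close>

text \<open>Here strands have life spans \<open>[S q, E q]\<close> in an abstract discrete time. Every moment is expanded into \<open>m * m\<close>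
  contacts, one for each pair \<open>x, y\<close> of strands; the contact for \<open>x, y\<close> squeezes all
  strands between \<open>x\<close> and \<open>y\<close> that are alive, if this is permitted, and nothing otherwise. In this way
  all permitted windows are realized and no choice has to be made.\<close>

locale timetable =
  fixes m T k :: nat and S E :: "nat \<Rightarrow> nat" and HL HR :: "nat set" and cl cr :: nat
  assumes m: "m > 0" and T: "T > 0" and k: "k > 0"
    and life: "q < m \<Longrightarrow> S q \<le> E q" "q < m \<Longrightarrow> E q < T"
    and HL: "q \<in> HL \<Longrightarrow> q < m \<and> q \<le> cl \<and> cl - q \<in> HL \<and> 2 * q \<noteq> cl \<and> S q = 0"
    and HR: "q \<in> HR \<Longrightarrow> q < m \<and> q \<le> cr \<and> cr - q \<in> HR \<and> 2 * q \<noteq> cr \<and> E q = T - 1"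
    and disj: "HL \<inter> HR = {}"
begin

abbreviation mate :: "nat \<Rightarrow> nat" where
  "mate \<equiv> partner HL HR cl cr"

definition span :: "nat \<Rightarrow> nat \<Rightarrow> nat \<Rightarrow> nat set" where
  "span t x y = {q. q < m \<and> x \<le> q \<and> q \<le> y \<and> S q \<le> t \<and> t \<le> E q}"

definition fits :: "nat \<Rightarrow> nat \<Rightarrow> nat \<Rightarrow> bool" where
  "fits t x y \<longleftrightarrow> card (span t x y) \<le> k \<and> (\<forall>u\<in>span t x y. mate u \<in> span t x y \<longrightarrow> mate u = u)"

definition slot_time :: "nat \<Rightarrow> nat" where "slot_time n = n div (m * m)"
definition slot_lo :: "nat \<Rightarrow> nat" where "slot_lo n = n mod (m * m) div m"
definition slot_hi :: "nat \<Rightarrow> nat" where "slot_hi n = n mod (m * m) mod m"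
definition slot_fits :: "nat \<Rightarrow> bool" where
  "slot_fits n \<longleftrightarrow> fits (slot_time n) (slot_lo n) (slot_hi n)"

text \<open>The bounds \<open>1\<close> and \<open>0\<close> describe the empty window.\<close>

definition lo :: "nat \<Rightarrow> nat" where "lo n = (if slot_fits n then slot_lo n else 1)"
definition hi :: "nat \<Rightarrow> nat" where "hi n = (if slot_fits n then slot_hi n else 0)"
definition first_contact :: "nat \<Rightarrow> nat" where "first_contact q = S q * (m * m)"
definition last_contact :: "nat \<Rightarrow> nat" where "last_contact q = E q * (m * m) + (m * m - 1)"

lemma slot_eqs:
  assumes "x < m" "y < m"
  shows "slot_time (t * (m * m) + (x * m + y)) = t" "slot_lo (t * (m * m) + (x * m + y)) = x"
    "slot_hi (t * (m * m) + (x * m + y)) = y"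
proof -
  have "x * m + y < x * m + m" using assms by simp
  also have "\<dots> = Suc x * m" by simp
  also have "\<dots> \<le> m * m" using assms by (intro mult_right_mono) auto
  finally have "x * m + y < m * m" .
  then show "slot_time (t * (m * m) + (x * m + y)) = t" "slot_lo (t * (m * m) + (x * m + y)) = x"
    "slot_hi (t * (m * m) + (x * m + y)) = y"
    using assms m by (simp_all add: slot_time_def slot_lo_def slot_hi_def)
qed

lemma slot_alive: "first_contact q \<le> n \<and> n \<le> last_contact q \<longleftrightarrow> S q \<le> slot_time n \<and> slot_time n \<le> E q"
proof -
  have "m * m > 0" using m by simp
  then have "first_contact q \<le> n \<longleftrightarrow> S q \<le> slot_time n"
    by (simp add: first_contact_def slot_time_def less_eq_div_iff_mult_less_eq)
  moreover have "n \<le> last_contact q \<longleftrightarrow> slot_time n < Suc (E q)"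
    unfolding slot_time_def div_less_iff_less_mult[OF \<open>m * m > 0\<close>] last_contact_def
    using \<open>m * m > 0\<close> unfolding mult_Suc by linarith
  ultimately show ?thesis by auto
qed

sublocale slots: contact_schedule m "T * (m * m)" k first_contact last_contact lo hi HL HR cl cr
proof
  fix q
  show "first_contact q \<le> last_contact q" if "q < m" using life(1)[OF that] by (simp add: first_contact_def last_contact_def trans_le_add1)
  show "last_contact q < T * (m * m)" if "q < m"
  proof -
    have "Suc (E q) * (m * m) \<le> T * (m * m)" using life(2)[OF that] by (intro mult_right_mono) auto
    moreover have "m * m > 0" using m by simp
    ultimately show ?thesis unfolding last_contact_def mult_Suc by linarith
  qed
  show "q \<in> HL \<Longrightarrow> q < m \<and> q \<le> cl \<and> cl - q \<in> HL \<and> 2 * q \<noteq> cl \<and> first_contact q = 0"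
    using HL by (simp add: first_contact_def)
  show "q \<in> HR \<Longrightarrow> q < m \<and> q \<le> cr \<and> cr - q \<in> HR \<and> 2 * q \<noteq> cr \<and> last_contact q = T * (m * m) - 1"
  proof -
    assume q: "q \<in> HR"
    have "(T - 1) * (m * m) + (m * m - 1) = T * (m * m) - 1"
      using T m by (cases T) auto
    then show ?thesis using HR[OF q] by (simp add: last_contact_def)
  qed
qed (use m T k disj in auto)

lemma slot_window: "slots.window n = (if slot_fits n then span (slot_time n) (slot_lo n) (slot_hi n) else {})"
  using slot_alive by (auto simp: slots.window_def span_def lo_def hi_def)

sublocale slots: touching_schedule m "T * (m * m)" k first_contact last_contact lo hi HL HR cl cr
  by unfold_locales (auto simp: slot_window slot_fits_def fits_def split: if_splits)

lemma strings_meet_if_fits: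
  assumes "x \<le> y" "y < m" "t < T" "fits t x y" "q \<in> span t x y" "r \<in> span t x y"
  shows "slots.string_of q \<inter> slots.string_of r \<noteq> {}"
proof (rule slots.strings_meet_in_window)
  let ?n = "t * (m * m) + (x * m + y)"
  have x: "x < m" using assms by simp
  note eqs = slot_eqs[OF x assms(2), of t]
  have "?n div (m * m) < T" using eqs(1) assms(3) by (simp only: slot_time_def)
  moreover have "m * m > 0" using m by simp
  ultimately show "?n < T * (m * m)" by (simp only: div_less_iff_less_mult)
  have "slots.window ?n = span t x y"
    unfolding slot_window slot_fits_def eqs using assms(4) by simp
  then show "q \<in> slots.window ?n" "r \<in> slots.window ?n" using assms by simp_all
qed

end

section \<open>Eleven bundles of strands\<close>

text \<open>The timetable of the bundles. Time is divided into the stages \<open>0, ..., 19\<close> of \<open>l\<close> moments each, the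
  last of which is cut off after its first moment.
  Bundle \<open>p\<close> is inserted during stage \<open>born p\<close> and removed during stage \<open>dies p\<close>, one strand at a time;
  exceptions are the bundles \<open>0\<close> and \<open>2\<close>, complete from the beginning, and the bundles \<open>3\<close> and \<open>10\<close>,
  complete up to the end. No two bundles change in the same stage, and all insertions precede all
  removals.\<close>

definition born :: "nat \<Rightarrow> nat" where
  "born p = [0, 1, 0, 7, 5, 4, 3, 2, 9, 8, 6] ! p"

definition dies :: "nat \<Rightarrow> nat" where
  "dies p = [17, 16, 14, 19, 13, 12, 10, 11, 15, 18, 19] ! p"

text \<open>Reflecting a strand in the axis of its fold leads to this bundle; bundles that are not folded are fixed.\<close>

definition joined :: "nat \<Rightarrow> nat" where
  "joined p = [2, 1, 0, 10, 4, 5, 6, 7, 8, 9, 3] ! p"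

text \<open>The side on which a strand sees no other strand of its own bundle at the moment of its insertion
  (removal): the upper side if the bundle is inserted from bottom to top (removed from top to bottom),
  the lower side otherwise.\<close>

definition born_up :: "nat \<Rightarrow> bool" where
  "born_up p \<longleftrightarrow> p = 3"

definition dies_up :: "nat \<Rightarrow> bool" where
  "dies_up p \<longleftrightarrow> p \<in> {0, 1, 2, 4, 5, 9}"

text \<open>The bundles from \<open>p\<close> to \<open>p'\<close> of which some strand can be alive during stage \<open>s\<close>.\<close>

definition zone :: "nat \<Rightarrow> nat \<Rightarrow> nat \<Rightarrow> nat list" where
  "zone s p p' = filter (\<lambda>b. born b \<le> s \<and> s \<le> dies b) [min p p'..<Suc (max p p')]"

text \<open>Stage \<open>s\<close> is meant to be the stage in which bundle \<open>p\<close> is inserted or removed, and \<open>up\<close> the free side of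
  its strands. Bundle \<open>p'\<close> is complete during this stage. If at most two bundles are involved, any
  window between them has at most \<open>2l\<close> strands. If three are involved, the window from a strand of \<open>p\<close>
  on its free side has one strand of \<open>p\<close> and at most \<open>2l\<close> others. Two bundles that are joined must not
  both be involved.\<close>

definition covered_at :: "nat \<Rightarrow> bool \<Rightarrow> nat \<Rightarrow> nat \<Rightarrow> bool" where
  "covered_at s up p p' \<longleftrightarrow> born p' < s \<and> s < dies p' \<and>
     (\<forall>b\<in>set (zone s p p'). joined b \<in> set (zone s p p') \<longrightarrow> joined b = b) \<and>
     (length (zone s p p') \<le> 2 \<or> length (zone s p p') \<le> 3 \<and> (up \<longleftrightarrow> p < p'))"

definition covered :: "nat \<Rightarrow> nat \<Rightarrow> bool" where
  "covered p p' \<longleftrightarrow> covered_at (born p) (born_up p) p p' \<or> covered_at (dies p) (dies_up p) p p'"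

text \<open>The combinatorial heart of the construction, a finite computation. A string of a hook may use either of
  its two strands.\<close>

lemma all_bundles_covered:
  "\<forall>p\<in>set [0..<11]. \<forall>p'\<in>set [0..<11]. p' \<noteq> p \<and> p' \<noteq> joined p \<longrightarrow>
     (\<exists>u\<in>{p, joined p}. \<exists>v\<in>{p', joined p'}. covered u v \<or> covered v u)"
  by code_simp

lemma table_props:
  "\<forall>p\<in>set [0..<11]. joined p < 11 \<and> joined (joined p) = p \<and> born p \<le> 9 \<and> 10 \<le> dies p \<and> dies p \<le> 19"
  by code_simp

text \<open>Strand \<open>q\<close> is strand number \<open>q mod l\<close> of bundle \<open>q div l\<close>.\<close>

definition start :: "nat \<Rightarrow> nat \<Rightarrow> nat" where
  "start l q = (let p = q div l; i = q mod l in
     if p = 0 \<or> p = 2 then 0 else born p * l + (if born_up p then i else l - 1 - i))"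

definition stop :: "nat \<Rightarrow> nat \<Rightarrow> nat" where
  "stop l q = (let p = q div l; i = q mod l in
     if p = 3 \<or> p = 10 then 19 * l else dies p * l + (if dies_up p then l - 1 - i else i))"

locale bundles =
  fixes l :: nat
  assumes l: "l > 0"
begin

lemma bundle_less: "q < 11 * l \<Longrightarrow> q div l < 11"
  using l by (simp add: div_less_iff_less_mult)

lemma start_bounds:
  assumes "q < 11 * l"
  shows "start l q < (born (q div l) + 1) * l" "start l q < 10 * l"
    "q div l \<noteq> 0 \<Longrightarrow> q div l \<noteq> 2 \<Longrightarrow> born (q div l) * l \<le> start l q"
proof -
  have "q mod l < l" using l by simp
  then show *: "start l q < (born (q div l) + 1) * l"
    using l by (auto simp: start_def Let_def add_mult_distrib)
  have "(born (q div l) + 1) * l \<le> 10 * l"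
    using table_props bundle_less[OF assms] by (intro mult_right_mono) auto
  then show "start l q < 10 * l" using * by linarith
  show "q div l \<noteq> 0 \<Longrightarrow> q div l \<noteq> 2 \<Longrightarrow> born (q div l) * l \<le> start l q"
    by (simp add: start_def Let_def)
qed

lemma stop_bounds:
  assumes "q < 11 * l"
  shows "dies (q div l) * l \<le> stop l q" "stop l q < (dies (q div l) + 1) * l" "10 * l \<le> stop l q" "stop l q \<le> 19 * l"
proof -
  have i: "q mod l < l" using l by simp
  have d: "dies 3 = 19" "dies 10 = 19" by (simp_all add: dies_def)
  show *: "dies (q div l) * l \<le> stop l q"
    by (auto simp: stop_def Let_def d)
  show "stop l q < (dies (q div l) + 1) * l"
    using l i by (auto simp: stop_def Let_def d add_mult_distrib)
  have p: "10 \<le> dies (q div l)" "dies (q div l) \<le> 19" using table_props bundle_less[OF assms] by auto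
  have "10 * l \<le> dies (q div l) * l" using p by (intro mult_right_mono) auto
  then show "10 * l \<le> stop l q" using * by linarith
  show "stop l q \<le> 19 * l"
  proof (cases "q div l = 3 \<or> q div l = 10")
    case True then show ?thesis by (auto simp: stop_def Let_def)
  next
    case False
    have "\<forall>p\<in>set [0..<11]. p \<noteq> 3 \<and> p \<noteq> 10 \<longrightarrow> dies p + 1 \<le> 19" by code_simp
    then have "dies (q div l) + 1 \<le> 19" using False bundle_less[OF assms] by auto
    then have "(dies (q div l) + 1) * l \<le> 19 * l" by (intro mult_right_mono) auto
    then show ?thesis using \<open>stop l q < (dies (q div l) + 1) * l\<close> by linarith
  qed
qed

definition HL :: "nat set" where "HL = {..<l} \<union> {2 * l..<3 * l}"
definition HR :: "nat set" where "HR = {3 * l..<4 * l} \<union> {10 * l..<11 * l}"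

lemma bundle_iff: "q div l = p \<longleftrightarrow> p * l \<le> q \<and> q < p * l + l"
proof
  assume "q div l = p"
  then show "p * l \<le> q \<and> q < p * l + l"
    using dividend_less_div_times[OF l, of q] by (auto simp: add.commute)
next
  assume "p * l \<le> q \<and> q < p * l + l"
  then show "q div l = p" by (intro div_nat_eqI) (auto simp: mult.commute)
qed

lemma HL_iff: "q \<in> HL \<longleftrightarrow> q div l = 0 \<or> q div l = 2"
  unfolding bundle_iff by (auto simp: HL_def)

lemma HR_iff: "q \<in> HR \<longleftrightarrow> q div l = 3 \<or> q div l = 10"
  unfolding bundle_iff by (auto simp: HR_def)

text \<open>Folding at the left maps strand \<open>i\<close> of bundle \<open>0\<close> to strand \<open>l - 1 - i\<close> of bundle \<open>2\<close>, the sum of the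
  indices being \<open>3 * l - 1\<close>; likewise \<open>14 * l - 1\<close> for the bundles \<open>3\<close> and \<open>10\<close>.\<close>

sublocale timetable "11 * l" "19 * l + 1" "2 * l + 1" "start l" "stop l" HL HR "3 * l - 1" "14 * l - 1"
proof
  fix q
  show "start l q \<le> stop l q" "stop l q < 19 * l + 1" if "q < 11 * l"
    using start_bounds(2)[OF that] stop_bounds(3,4)[OF that] by linarith+
  show "q < 11 * l \<and> q \<le> 3 * l - 1 \<and> 3 * l - 1 - q \<in> HL \<and> 2 * q \<noteq> 3 * l - 1 \<and> start l q = 0" if "q \<in> HL"
    using that l HL_iff[of q] by (auto simp: HL_def start_def Let_def)
  show "q < 11 * l \<and> q \<le> 14 * l - 1 \<and> 14 * l - 1 - q \<in> HR \<and> 2 * q \<noteq> 14 * l - 1 \<and> stop l q = 19 * l + 1 - 1" if "q \<in> HR"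
    using that l HR_iff[of q] by (auto simp: HR_def stop_def Let_def)
  show "HL \<inter> HR = {}" by (auto simp: HL_def HR_def)
qed (use l in auto)

lemma mate_bundle:
  assumes "q < 11 * l"
  shows "mate q < 11 * l" "mate q div l = joined (q div l)" "mate (mate q) = q" 
    "joined (q div l) = q div l \<Longrightarrow> mate q = q"
proof -
  show "mate q < 11 * l" "mate (mate q) = q" using slots.mate_props assms by auto
  have "mate q div l = joined (q div l) \<and> (joined (q div l) = q div l \<longrightarrow> mate q = q)"
  proof -
    consider "q < l" | "2 * l \<le> q" "q < 3 * l" | "3 * l \<le> q" "q < 4 * l" | "10 * l \<le> q" "q < 11 * l" | "q \<notin> HL" "q \<notin> HR"
      by (auto simp: HL_def HR_def)
    then show ?thesis
    proof cases
      case 1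
      then have "q div l = 0" "(3 * l - 1 - q) div l = 2" by (auto simp: bundle_iff simp del: div_less)
      then show ?thesis using 1 by (simp add: partner_def HL_def joined_def)
    next
      case 2
      then have "q div l = 2" "(3 * l - 1 - q) div l = 0" by (auto simp: bundle_iff simp del: div_less)
      then show ?thesis using 2 by (simp add: partner_def HL_def joined_def)
    next
      case 3
      then have "q div l = 3" "(14 * l - 1 - q) div l = 10" by (auto simp: bundle_iff simp del: div_less)
      then show ?thesis using 3 by (simp add: partner_def HL_def HR_def joined_def)
    next
      case 4
      then have "q div l = 10" "(14 * l - 1 - q) div l = 3" by (auto simp: bundle_iff simp del: div_less)
      then show ?thesis using 4 by (simp add: partner_def HL_def HR_def joined_def)
    next
      case 5
      have "\<forall>p\<in>set [0..<11]. p \<noteq> 0 \<and> p \<noteq> 2 \<and> p \<noteq> 3 \<and> p \<noteq> 10 \<longrightarrow> joined p = p" by code_simp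
      then show ?thesis using 5 bundle_less[OF assms] by (auto simp: partner_def HL_iff HR_iff)
    qed
  qed
  then show "mate q div l = joined (q div l)" "joined (q div l) = q div l \<Longrightarrow> mate q = q" by auto
qed

lemma card_bundle: "card {q. q div l = p} = l" "finite {q. q div l = p}"
proof -
  have "{q. q div l = p} = {p * l..<p * l + l}" by (auto simp: bundle_iff)
  then show "card {q. q div l = p} = l" "finite {q. q div l = p}" by auto
qed

lemma card_bundles_le:
  assumes "finite Z"
  shows "card {q. q div l \<in> Z} \<le> card Z * l" "finite {q. q div l \<in> Z}"
proof -
  have eq: "{q. q div l \<in> Z} = (\<Union>p\<in>Z. {q. q div l = p})" by auto
  show "card {q. q div l \<in> Z} \<le> card Z * l"
    unfolding eq using card_UN_le[OF assms, of "\<lambda>p. {q. q div l = p}"] by (simp add: card_bundle)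
  show "finite {q. q div l \<in> Z}" unfolding eq using assms card_bundle by auto
qed

definition meets :: "nat \<Rightarrow> nat \<Rightarrow> bool" where
  "meets x y \<longleftrightarrow> slots.string_of x \<inter> slots.string_of y \<noteq> {}"

lemma meets_sym: "meets x y \<Longrightarrow> meets y x" by (auto simp: meets_def)

lemma meets_mate: "x < 11 * l \<Longrightarrow> u \<in> {x, mate x} \<Longrightarrow> meets u y = meets x y"
  using slots.string_of_mate by (auto simp: meets_def)

text \<open>The two reasons for a window to be small enough: it stays in two bundles, or it stays in three and
  contains only one strand of one of them.\<close>

lemma fits_if_bundles:
  assumes Z: "finite Z" "span t x y \<subseteq> {q. q div l \<in> Z}"
    and nomate: "\<And>p. p \<in> Z \<Longrightarrow> joined p \<in> Z \<Longrightarrow> joined p = p"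
    and few: "card Z \<le> 2 \<or> card Z \<le> 3 \<and> p \<in> Z \<and> span t x y \<inter> {q. q div l = p} \<subseteq> {z}"
  shows "fits t x y"
  unfolding fits_def
proof
  show "\<forall>u\<in>span t x y. mate u \<in> span t x y \<longrightarrow> mate u = u"
  proof (intro ballI impI)
    fix u assume u: "u \<in> span t x y" "mate u \<in> span t x y"
    have "u div l \<in> Z" "mate u div l \<in> Z" using Z(2) u by blast+
    moreover have "u < 11 * l" using u(1) unfolding span_def by blast
    ultimately show "mate u = u" using nomate[of "u div l"] mate_bundle(2,4)[of u] by metis
  qed
  from few show "card (span t x y) \<le> 2 * l + 1"
  proof
    assume "card Z \<le> 2"
    then have "card Z * l \<le> 2 * l" by (intro mult_right_mono) auto
    moreover have "card (span t x y) \<le> card Z * l"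
      using card_bundles_le[OF Z(1)] card_mono[OF _ Z(2)] by linarith
    ultimately show ?thesis by linarith
  next
    assume *: "card Z \<le> 3 \<and> p \<in> Z \<and> span t x y \<inter> {q. q div l = p} \<subseteq> {z}"
    let ?A = "{q. q div l \<in> Z - {p}}"
    have fin: "finite (Z - {p})" using Z(1) by simp
    have "card (Z - {p}) \<le> 2" using * Z(1) by auto
    then have "card (Z - {p}) * l \<le> 2 * l" by (rule mult_right_mono) simp
    then have "card ?A \<le> 2 * l" using card_bundles_le(1)[OF fin] by linarith
    moreover have "span t x y \<subseteq> insert z ?A" using * Z(2) by auto
    then have "card (span t x y) \<le> card (insert z ?A)"
      using card_bundles_le(2)[OF fin] by (intro card_mono) auto
    moreover have "card (insert z ?A) \<le> Suc (card ?A)"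
      using card_bundles_le(2)[OF fin] by (simp only: card_insert_if) auto
    ultimately show ?thesis by linarith
  qed
qed

lemma alive_in_stage:
  assumes "q < 11 * l" "start l q \<le> t" "t \<le> stop l q" "s * l \<le> t" "t < Suc s * l"
  shows "born (q div l) \<le> s" "s \<le> dies (q div l)"
proof -
  have "born (q div l) * l < Suc s * l"
  proof (cases "q div l = 0 \<or> q div l = 2")
    case True then show ?thesis using l by (auto simp: born_def)
  next
    case False then show ?thesis using start_bounds(3)[OF assms(1)] assms by linarith
  qed
  then show "born (q div l) \<le> s" by (auto simp only: mult_less_cancel2 less_Suc_eq_le)
  have "s * l < Suc (dies (q div l)) * l" using stop_bounds(2)[OF assms(1)] assms by simp
  then show "s \<le> dies (q div l)" by (auto simp only: mult_less_cancel2 less_Suc_eq_le)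
qed

lemma zone_iff: "b \<in> set (zone s p p') \<longleftrightarrow> min p p' \<le> b \<and> b \<le> max p p' \<and> born b \<le> s \<and> s \<le> dies b"
  unfolding zone_def set_filter set_upt by auto

text \<open>The contact takes place at the moment \<open>t\<close> at which \<open>x\<close> is inserted or removed. The hypothesis
  \<open>extreme\<close> says that at this moment \<open>x\<close> is the outermost strand of its bundle on the side \<open>up\<close>.\<close>

lemma meets_if_covered_at:
  assumes x: "x < 11 * l" and y: "y < 11 * l" and cov: "covered_at s up (x div l) (y div l)" and ne: "x div l \<noteq> y div l"
    and t: "t \<in> {start l x, stop l x}" "s * l \<le> t" "t < Suc s * l"
    and extreme: "\<And>q. q div l = x div l \<Longrightarrow> start l q \<le> t \<Longrightarrow> t \<le> stop l q \<Longrightarrow> (if up then q \<le> x else x \<le> q)"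
  shows "meets x y"
proof -
  define lo where "lo = min x y"
  define hi where "hi = max x y"
  let ?p = "x div l" and ?p' = "y div l"
  define Z where "Z = set (zone s ?p ?p')"
  have alive_x: "start l x \<le> t" "t \<le> stop l x" using t(1) life(1)[OF x] by auto
  have alive_y: "start l y \<le> t" "t \<le> stop l y"
  proof -
    have s: "born ?p' < s" "s < dies ?p'" using cov by (auto simp: covered_at_def)
    have "(born ?p' + 1) * l \<le> s * l" "Suc s * l \<le> dies ?p' * l" using s by (intro mult_right_mono; simp)+
    then show "start l y \<le> t" "t \<le> stop l y" using start_bounds(1)[OF y] stop_bounds(1)[OF y] t by linarith+
  qed
  have tT: "t < 19 * l + 1" using alive_x life(2)[OF x] by linarith
  have inZ: "q div l \<in> Z" if "q \<in> span t lo hi" for q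
  proof -
    have "min ?p ?p' \<le> q div l" "q div l \<le> max ?p ?p'"
      using that div_le_mono[of x q l] div_le_mono[of y q l] div_le_mono[of q x l] div_le_mono[of q y l]
      by (auto simp: span_def lo_def hi_def min_def max_def split: if_splits)
    then show ?thesis
      using alive_in_stage[of q t s] t that unfolding Z_def zone_iff span_def by blast
  qed
  have mem: "x \<in> span t lo hi" "y \<in> span t lo hi"
    using x y alive_x alive_y by (auto simp: span_def lo_def hi_def)
  have cardZ: "card Z = length (zone s ?p ?p')"
    unfolding Z_def zone_def by (intro distinct_card distinct_filter distinct_upt)
  have "fits t lo hi"
  proof (rule fits_if_bundles[where Z = Z and p = ?p and z = x])
    show "finite Z" by (simp add: Z_def)
    show "span t lo hi \<subseteq> {q. q div l \<in> Z}" using inZ by blast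
    show "joined p = p" if "p \<in> Z" "joined p \<in> Z" for p using that cov by (simp add: covered_at_def Z_def)
    have "q = x" if "q \<in> span t lo hi" "q div l = ?p" "up \<longleftrightarrow> ?p < ?p'" for q
    proof -
      have e: "if up then q \<le> x else x \<le> q" using extreme[of q] that by (auto simp: span_def)
      have "?p < ?p' \<longleftrightarrow> x < y" using ne div_le_mono[of x y l] div_le_mono[of y x l] by linarith
      then show ?thesis using e that by (auto simp: span_def lo_def hi_def min_def max_def split: if_splits)
    qed
    then show "card Z \<le> 2 \<or> card Z \<le> 3 \<and> ?p \<in> Z \<and> span t lo hi \<inter> {q. q div l = ?p} \<subseteq> {x}"
      using cov inZ[OF mem(1)] unfolding covered_at_def cardZ by blast
  qed
  then show ?thesis
    unfolding meets_def using strings_meet_if_fits[of lo hi t x y] mem x y tT by (auto simp: lo_def hi_def)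
qed

lemma meets_if_covered:
  assumes x: "x < 11 * l" and y: "y < 11 * l" and cov: "covered (x div l) (y div l)" and ne: "x div l \<noteq> y div l"
  shows "meets x y"
proof -
  have below: "q mod l < l" for q using l by simp
  have cmp: "q \<le> x \<longleftrightarrow> q mod l \<le> x mod l" "x \<le> q \<longleftrightarrow> x mod l \<le> q mod l" if "q div l = x div l" for q
    using that div_mult_mod_eq[of q l] div_mult_mod_eq[of x l] by (metis add_le_cancel_left)+
  from cov[unfolded covered_def] show ?thesis
  proof
    assume c: "covered_at (born (x div l)) (born_up (x div l)) (x div l) (y div l)"
    have "born (x div l) \<noteq> 0" using c by (auto simp: covered_at_def)
    moreover have "born 0 = 0" "born 2 = 0" by (simp_all add: born_def)
    ultimately have "x div l \<noteq> 0" "x div l \<noteq> 2" by metis+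
    then have st: "start l q = born (x div l) * l + (if born_up (x div l) then q mod l else l - 1 - q mod l)"
      if "q div l = x div l" for q using that by (simp add: start_def)
    show ?thesis
    proof (rule meets_if_covered_at[OF x y c ne, of "start l x"])
      show "born (x div l) * l \<le> start l x" "start l x < Suc (born (x div l)) * l"
        using st[of x] below[of x] by auto
      fix q assume q: "q div l = x div l" "start l q \<le> start l x"
      then show "if born_up (x div l) then q \<le> x else x \<le> q"
        using st[of x] st[of q] cmp[of q] below[of q] below[of x] by (auto split: if_splits)
    qed simp
  next
    assume c: "covered_at (dies (x div l)) (dies_up (x div l)) (x div l) (y div l)"
    have "dies (y div l) \<le> 19" using table_props bundle_less[OF y] by auto
    then have "dies (x div l) < 19" using c by (auto simp: covered_at_def)
    then have "x div l \<noteq> 3" "x div l \<noteq> 10" by (auto simp: dies_def)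
    then have st: "stop l q = dies (x div l) * l + (if dies_up (x div l) then l - 1 - q mod l else q mod l)"
      if "q div l = x div l" for q using that by (simp add: stop_def)
    show ?thesis
    proof (rule meets_if_covered_at[OF x y c ne, of "stop l x"])
      show "dies (x div l) * l \<le> stop l x" "stop l x < Suc (dies (x div l)) * l"
        using st[of x] below[of x] by auto
      fix q assume q: "q div l = x div l" "stop l x \<le> stop l q"
      show "if dies_up (x div l) then q \<le> x else x \<le> q"
      proof (cases "dies_up (x div l)")
        case True
        then have "l - 1 - x mod l \<le> l - 1 - q mod l" using q st[OF q(1)] st[OF refl] by simp
        then have "q mod l \<le> x mod l" using below[of q] below[of x] by linarith
        then show ?thesis using True cmp(1)[OF q(1)] by simp
      next
        case False
        then show ?thesis using q st[OF q(1)] st[OF refl] cmp(2)[OF q(1)] by simp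
      qed
    qed simp
  qed
qed

text \<open>At time \<open>10 * l\<close> all strands are alive.\<close>

lemma meets_same_bundle:
  assumes x: "x < 11 * l" and y: "y < 11 * l" and eq: "x div l = y div l" and le: "x \<le> y"
  shows "meets x y"
proof -
  have div: "q div l = x div l" if "q \<in> span (10 * l) x y" for q
    using that div_le_mono[of x q l] div_le_mono[of q y l] eq by (auto simp: span_def)
  have mem: "x \<in> span (10 * l) x y" "y \<in> span (10 * l) x y"
    using x y le start_bounds(2) stop_bounds(3) by (auto simp: span_def less_imp_le)
  have "fits (10 * l) x y"
    by (rule fits_if_bundles[where Z = "{x div l}" and p = "x div l" and z = x]) (use div in auto)
  then show ?thesis
    unfolding meets_def using strings_meet_if_fits[of x y "10 * l" x y] mem le y by simp
qed

lemma all_meet: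
  assumes x: "x < 11 * l" and y: "y < 11 * l"
  shows "meets x y"
proof -
  have same: "meets u v" if "u < 11 * l" "v < 11 * l" "u div l = v div l" for u v
  proof (cases "u \<le> v")
    case True
    then show ?thesis using meets_same_bundle that by blast
  next
    case False
    then show ?thesis using meets_same_bundle[OF that(2,1)] that(3) meets_sym by simp
  qed
  consider "y div l = x div l" | "y div l = joined (x div l)" | "y div l \<noteq> x div l" "y div l \<noteq> joined (x div l)" by blast
  then show ?thesis
  proof cases
    case 1 then show ?thesis using same x y by simp
  next
    case 2
    then have "meets (mate x) y" using same mate_bundle[OF x] y by simp
    then show ?thesis using meets_mate[OF x, of "mate x" y] by blast
  next
    case 3
    have "\<exists>u\<in>{x div l, joined (x div l)}. \<exists>v\<in>{y div l, joined (y div l)}. covered u v \<or> covered v u"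
    proof -
      have "x div l \<in> set [0..<11]" "y div l \<in> set [0..<11]" using bundle_less[OF x] bundle_less[OF y] by auto
      from bspec[OF bspec[OF all_bundles_covered this(1)] this(2)] 3 show ?thesis by blast
    qed
    then obtain p p' where p: "p \<in> {x div l, joined (x div l)}" "p' \<in> {y div l, joined (y div l)}"
      and cov: "covered p p' \<or> covered p' p" by blast
    obtain u where u: "u \<in> {x, mate x}" "u div l = p" using p(1) mate_bundle(2)[OF x] by blast
    obtain v where v: "v \<in> {y, mate y}" "v div l = p'" using p(2) mate_bundle(2)[OF y] by blast
    have lt: "u < 11 * l" "v < 11 * l" using u(1) v(1) x y mate_bundle(1) by blast+
    have invol: "joined (joined (x div l)) = x div l" "joined (joined (y div l)) = y div l"
      using table_props bundle_less[OF x] bundle_less[OF y] by auto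
    have ne: "p \<noteq> p'"
    proof
      assume "p = p'"
      then have "y div l = x div l \<or> y div l = joined (x div l)" using p invol by (metis empty_iff insert_iff)
      with 3 show False by simp
    qed
    have "meets u v" using cov
    proof
      assume "covered p p'"
      then show ?thesis using meets_if_covered[OF lt] ne unfolding u(2) v(2) by blast
    next
      assume "covered p' p"
      then show ?thesis using meets_if_covered[OF lt(2,1)] ne meets_sym unfolding u(2) v(2) by metis
    qed
    then have "meets x v" using meets_mate[OF x u(1)] by simp
    then have "meets v x" by (rule meets_sym)
    then have "meets y x" using meets_mate[OF y v(1)] by simp
    then show ?thesis by (rule meets_sym)
  qed
qed

text \<open>Bundles \<open>2\<close> and \<open>3\<close> only contain second halves of hooks.\<close>

lemma card_strings: "card (slots.string_of ` {..<11 * l}) = 9 * l"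
proof -
  define R where "R = {..<2 * l} \<union> {4 * l..<11 * l}"
  have R: "q \<in> R \<longleftrightarrow> q < 11 * l \<and> q div l \<noteq> 2 \<and> q div l \<noteq> 3" for q
    unfolding bundle_iff R_def by auto
  have "slots.string_of ` {..<11 * l} = slots.string_of ` R"
  proof
    show "slots.string_of ` {..<11 * l} \<subseteq> slots.string_of ` R"
    proof clarify
      fix q assume q: "q < 11 * l"
      have "q \<in> R \<or> mate q \<in> R"
        using q mate_bundle[OF q] by (auto simp: R joined_def)
      then show "slots.string_of q \<in> slots.string_of ` R"
        using slots.string_of_mate[of q] q by (metis imageI lessThan_iff)
    qed
  qed (auto simp: R)
  moreover have "inj_on slots.string_of R"
  proof (rule inj_onI)
    fix q r assume qr: "q \<in> R" "r \<in> R" "slots.string_of q = slots.string_of r"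
    then have "r = q \<or> r = mate q" using slots.inj_string_of by (simp add: R)
    moreover have "mate q = q" if "mate q \<in> R"
    proof -
      have "\<forall>p\<in>set [0..<11]. p \<noteq> 2 \<and> p \<noteq> 3 \<and> joined p \<noteq> 2 \<and> joined p \<noteq> 3 \<longrightarrow> joined p = p" by code_simp
      then have "joined (q div l) = q div l"
        using that qr(1) mate_bundle(2)[of q] bundle_less[of q] by (auto simp: R)
      then show ?thesis using mate_bundle(4) qr(1) by (simp add: R)
    qed
    ultimately show "q = r" using qr(2) by auto
  qed
  moreover have "card R = 2 * l + 7 * l"
    unfolding R_def by (subst card_Un_disjoint) auto
  ultimately show ?thesis by (simp add: card_image)
qed

end

section \<open>Pairwise intersecting strings\<close>

lemma string_chi_of_clique:
  assumes "finite S" "pairwise (\<lambda>s t. s \<inter> t \<noteq> {}) S"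
  shows "string_chi S = card S"
proof -
  have edge: "{s, t} \<in> intersection_edges S \<longleftrightarrow> s \<noteq> t" if "s \<in> S" "t \<in> S" for s t
  proof
    show "{s, t} \<in> intersection_edges S \<Longrightarrow> s \<noteq> t"
      unfolding intersection_edges_def by (auto simp: doubleton_eq_iff)
    show "s \<noteq> t \<Longrightarrow> {s, t} \<in> intersection_edges S"
      using that pairwiseD[OF assms(2), of s t] unfolding intersection_edges_def by blast
  qed
  obtain c where c: "bij_betw c S {0..<card S}" using ex_bij_betw_finite_nat[OF assms(1)] by blast
  show ?thesis
    unfolding string_chi_def chromatic_number_def
  proof (rule Least_equality)
    show "\<exists>c. proper_colouring S (intersection_edges S) (card S) c"
      unfolding proper_colouring_def
      by (intro exI[of _ c]) (use c edge in \<open>auto simp: bij_betw_def inj_on_def\<close>)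
    fix n assume "\<exists>c. proper_colouring S (intersection_edges S) n c"
    then obtain c where c: "c ` S \<subseteq> {..<n}" "\<forall>u\<in>S. \<forall>v\<in>S. {u, v} \<in> intersection_edges S \<longrightarrow> c u \<noteq> c v"
      by (auto simp: proper_colouring_def)
    have "inj_on c S" using c(2) edge by (auto intro!: inj_onI)
    then show "card S \<le> n" using card_inj_on_le[OF _ c(1)] by simp
  qed
qed

theorem theorem2p8:
  fixes k l :: nat
  assumes "odd k" and "k \<ge> 1" and "k = 2 * l + 1"
  shows "\<exists>S :: (real^2) set set.
           k_touching k S \<and>
           pairwise (\<lambda>s t. s \<inter> t \<noteq> {}) S \<and>
           card S = 9 * l \<and>
           real (card S) = 9 * (real k - 1) / 2 \<and>
           string_chi S = 9 * l \<and>
           int (string_chi S) = \<lceil>9 * real k / 2\<rceil> - 5"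
proof -
  have "\<exists>S :: (real^2) set set. k_touching k S \<and> pairwise (\<lambda>s t. s \<inter> t \<noteq> {}) S \<and> card S = 9 * l"
  proof (cases "l = 0")
    case True
    then show ?thesis
      by (intro exI[of _ "{}"]) (simp add: k_touching_def touching_def string_set_def)
  next
    case False
    then interpret bundles l by unfold_locales simp
    show ?thesis
    proof (intro exI conjI)
      show "k_touching k (slots.string_of ` {..<11 * l})"
        using slots.k_touching_strings assms(3) by simp
      show "pairwise (\<lambda>s t. s \<inter> t \<noteq> {}) (slots.string_of ` {..<11 * l})"
        using all_meet by (auto simp: pairwise_def meets_def)
      show "card (slots.string_of ` {..<11 * l}) = 9 * l" by (rule card_strings)
    qed
  qed
  then obtain S :: "(real^2) set set" where S: "k_touching k S" "pairwise (\<lambda>s t. s \<inter> t \<noteq> {}) S" "card S = 9 * l"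
    by blast
  have "finite S" using S(1) by (simp add: k_touching_def touching_def string_set_def)
  then have chi: "string_chi S = 9 * l" using string_chi_of_clique S by metis
  have "\<lceil>9 * real k / 2\<rceil> = 9 * int l + 5"
    by (rule ceiling_unique) (simp_all add: assms(3))
  then show ?thesis using S chi assms(3) by (intro exI[of _ S]) simp
qed

end
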